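(* Let $M_1$ and $M_2$ be matroids both of rank $k$ on the same ground set $E$ such that $M_1\preceq M_2$ in the weak order. Then $\widehat{\rho}(I(M_1)) \le \widehat{\rho}(I(M_2))$ and $\widehat{\rho}(I_{\Delta(M_1)})\le \widehat{\rho}(I_{\Delta(M_2)})$.
   Context: Let $\mathbb{K}$ be a field, $S=\mathbb{K}[x_e : e\in E]$ the standard graded polynomial ring, and $x^U=\prod_{i\in U}x_i$ for $U\subseteq E$. For a squarefree monomial ideal $I\subseteq S$ and $s\ge 1$, the $s$-th symbolic power is $I^{(s)}=\bigcap_{P\in \mathrm{Min}(I)}P^s$, where $\mathrm{Min}(I)$ is the set of minimal primes of $I$. The asymptotic resurgence is $\widehat{\rho}(I)=\sup\{ s/r : s,r \text{ positive integers and } I^{(st)}\not\subseteq I^{rt}\text{ for all } t\gg 0\}$. For a matroid $M$ on $E$ with set of bases $\mathcal{B}(M)$ and set of circuits $\mathcal{C}(M)$, the facet ideal is $I(M)=\langle x^B : B\in\mathcal{B}(M)\rangle$, and the Stanley-Reisner ideal (of the independence complex $\Delta(M)$) is $I_{\Delta(M)}=\langle x^C : C\in\mathcal{C}(M)\rangle$. Weak order: for matroids $M,N$ on $E$, $M\preceq N$ means that every subset of $E$ independent in $M$ is also independent in $N$; when $M$ and $N$ have the same rank this is equivalent to $\mathcal{B}(M)\subseteq\mathcal{B}(N)$. Standing assumption: $k<|E|$. *)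

theory Defs
  imports
    "HOL-Algebra.Ideal_Product"
    "HOL-Algebra.Algebraic_Closure_Type"
    "HOL-Library.Poly_Mapping"
    "HOL-Library.Extended_Real"
begin

section \<open>Matroids\<close>

text \<open>A matroid is given by its finite ground set and its independent sets.\<close>

locale matroid =
  fixes E :: "'e set" and indep :: "'e set \<Rightarrow> bool"
  assumes finite_ground: "finite E"
    and indep_in_ground: "indep A \<Longrightarrow> A \<subseteq> E"
    and indep_empty: "indep {}"
    and indep_subset: "indep A \<Longrightarrow> A' \<subseteq> A \<Longrightarrow> indep A'"
    and augmentation:
      "indep A \<Longrightarrow> indep A' \<Longrightarrow> card A < card A' \<Longrightarrow> \<exists>y\<in>A' - A. indep (insert y A)"

definition matroid_rank :: "('e set \<Rightarrow> bool) \<Rightarrow> nat" where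
  "matroid_rank indep = Max (card ` {A. indep A})"

definition matroid_bases :: "('e set \<Rightarrow> bool) \<Rightarrow> 'e set set" where
  "matroid_bases indep = {B. indep B \<and> (\<forall>A. indep A \<longrightarrow> B \<subseteq> A \<longrightarrow> A = B)}"

definition matroid_circuits :: "'e set \<Rightarrow> ('e set \<Rightarrow> bool) \<Rightarrow> 'e set set" where
  "matroid_circuits E indep = {C. C \<subseteq> E \<and> \<not> indep C \<and> (\<forall>A. A \<subset> C \<longrightarrow> indep A)}"

definition weak_order_le :: "('e set \<Rightarrow> bool) \<Rightarrow> ('e set \<Rightarrow> bool) \<Rightarrow> bool" where
  "weak_order_le indep1 indep2 \<longleftrightarrow> (\<forall>A. indep1 A \<longrightarrow> indep2 A)"


section \<open>Symbolic powers and asymptotic resurgence\<close>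

definition ideal_power :: "('a, 'b) ring_scheme \<Rightarrow> 'a set \<Rightarrow> nat \<Rightarrow> 'a set" where
  "ideal_power R I n = I [^]\<^bsub>ideals_set R\<^esub> n"

definition minimal_primes :: "('a, 'b) ring_scheme \<Rightarrow> 'a set \<Rightarrow> 'a set set" where
  "minimal_primes R I =
     {P. primeideal P R \<and> I \<subseteq> P \<and> (\<forall>Q. primeideal Q R \<longrightarrow> I \<subseteq> Q \<longrightarrow> Q \<subseteq> P \<longrightarrow> Q = P)}"

text \<open>This is the description of symbolic powers valid for squarefree monomial ideals, the only
  ideals it is meant for. The carrier is the value of the empty intersection, which arises only
  for the unit ideal.\<close>

definition symbolic_power :: "('a, 'b) ring_scheme \<Rightarrow> 'a set \<Rightarrow> nat \<Rightarrow> 'a set" where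
  "symbolic_power R I s = carrier R \<inter> (\<Inter>P\<in>minimal_primes R I. ideal_power R P s)"

text \<open>The supremum is taken in the extended reals, so that it is meaningful without a
  boundedness proof. The index set is empty for the unit ideal.\<close>

definition asymptotic_resurgence :: "('a, 'b) ring_scheme \<Rightarrow> 'a set \<Rightarrow> ereal" where
  "asymptotic_resurgence R I =
     Sup {ereal (real s / real r) | s r. 0 < s \<and> 0 < r \<and>
            (\<forall>\<^sub>F t in sequentially. \<not> symbolic_power R I (s * t) \<subseteq> ideal_power R I (r * t))}"


section \<open>The polynomial ring and the ideals of a matroid\<close>

text \<open>The ground set of the matroids is the whole finite type \<open>'e\<close>; the variables of the
  polynomial ring are indexed by it. A polynomial maps exponent vectors to coefficients.\<close>

type_synonym ('e, 'k) mpoly = "('e \<Rightarrow>\<^sub>0 nat) \<Rightarrow>\<^sub>0 'k"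

definition mpoly_ring :: "('e::finite, 'k::field) mpoly ring" where
  "mpoly_ring = ring_of_type_algebra"

lemma cring_mpoly_ring: "cring (mpoly_ring :: ('e::finite, 'k::field) mpoly ring)"
  unfolding mpoly_ring_def by (rule cring_from_type_algebra)

definition mpoly_var :: "'e::finite \<Rightarrow> ('e, 'k::field) mpoly" where
  "mpoly_var e = Poly_Mapping.single (Poly_Mapping.single e 1) 1"

definition squarefree_monomial :: "'e::finite set \<Rightarrow> ('e, 'k::field) mpoly" where
  "squarefree_monomial U = (\<Prod>e\<in>U. mpoly_var e)"

definition facet_ideal :: "('e::finite set \<Rightarrow> bool) \<Rightarrow> ('e, 'k::field) mpoly set" where
  "facet_ideal indep = Idl\<^bsub>mpoly_ring\<^esub> (squarefree_monomial ` matroid_bases indep)"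

definition stanley_reisner_ideal :: "('e::finite set \<Rightarrow> bool) \<Rightarrow> ('e, 'k::field) mpoly set" where
  "stanley_reisner_ideal indep =
     Idl\<^bsub>mpoly_ring\<^esub> (squarefree_monomial ` matroid_circuits UNIV indep)"

end

theory Submission
  imports Defs "HOL-Analysis.Convex_Euclidean_Space" "HOL-Analysis.Finite_Cartesian_Product"
begin

text \<open>For the ideal \<open>I\<close> generated by the squarefree monomials \<open>x\<^sup>U\<close> with \<open>U\<close> in a family \<open>\<A>\<close>,
  the reciprocal of the asymptotic resurgence is the minimum of \<open>a \<bullet> b\<close> over all \<open>a\<close> in the symbolic
  polyhedron of \<open>I\<close> (\<open>a \<ge> 0\<close> and \<open>a(D) \<ge> 1\<close> for all vertex covers \<open>D\<close> of \<open>\<A>\<close>) and all \<open>b\<close> in the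
  blocker of its Newton polyhedron (\<open>b \<ge> 0\<close> and \<open>b(U) \<ge> 1\<close> for all \<open>U\<close> in \<open>\<A>\<close>). Hence it suffices to
  turn each such pair for the first matroid into one for the second without increasing \<open>a \<bullet> b\<close>.

  For the bases of a matroid of rank \<open>k\<close>, the greedy algorithm applied to the weights \<open>b\<close>, together
  with a decomposition of \<open>b\<close> into level sets, yields an independent set \<open>I\<close> of size less than \<open>k\<close>
  with \<open>a(E - cl I) \<le> (k - |I|) (a \<bullet> b)\<close>. Since \<open>I\<close> stays independent in the larger matroid, one may
  replace \<open>b\<close> by the constant \<open>1/(k - |I|)\<close> off \<open>I\<close> and move the weight \<open>a\<close> from \<open>cl I\<close> to \<open>I\<close>.

  The Stanley-Reisner case follows by duality: circuits and complements of bases block each other,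
  so passing to the dual matroid exchanges the roles of \<open>a\<close> and \<open>b\<close>.\<close>

section \<open>Blocking pairs of matroids\<close>

definition covers :: "'e set set \<Rightarrow> 'e set \<Rightarrow> bool" where
  "covers \<A> D \<longleftrightarrow> (\<forall>U\<in>\<A>. U \<inter> D \<noteq> {})"

text \<open>All covers are quantified over, not only the minimal ones. For nonnegative
  \<open>a\<close> this is the same condition, and it spares minimality arguments whenever a pair is
  constructed.\<close>

definition blocking_pair :: "'e::finite set set \<Rightarrow> ('e \<Rightarrow> real) \<Rightarrow> ('e \<Rightarrow> real) \<Rightarrow> bool" where
  "blocking_pair \<A> a b \<longleftrightarrow> (\<forall>e. 0 \<le> a e) \<and> (\<forall>e. 0 \<le> b e) \<and>
     (\<forall>D. covers \<A> D \<longrightarrow> 1 \<le> sum a D) \<and> (\<forall>U\<in>\<A>. 1 \<le> sum b U)"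

text \<open>A nonnegative \<open>b\<close> is a nonnegative combination of the indicators of its
  strict superlevel sets, so the weighted sum is the same combination of the level sums of
  \<open>c\<close>. The induction on the size of the support peels off one layer at a time.\<close>

lemma sum_mult_nonneg_of_level_sums_nonneg:
  fixes b c :: "'e::finite \<Rightarrow> real"
  assumes "\<And>e. 0 \<le> b e" and "\<And>t. 0 \<le> t \<Longrightarrow> 0 \<le> (\<Sum>e | t < b e. c e)"
  shows "0 \<le> (\<Sum>e\<in>UNIV. c e * b e)"
  using assms
proof (induction "card {e. 0 < b e}" arbitrary: b rule: less_induct)
  case less
  show ?case
  proof (cases "{e. 0 < b e} = {}")
    case True
    then have "b e = 0" for e
      using less.prems(1)[of e] by (simp add: order.antisym not_less)
    then show ?thesis by simp
  next
    case False
    define m where "m = Min (b ` {e. 0 < b e})"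
    have m_in: "m \<in> b ` {e. 0 < b e}"
      unfolding m_def using False by (intro Min_in) auto
    then have m_pos: "0 < m" by auto
    have m_le: "m \<le> b e" if "0 < b e" for e
      unfolding m_def using that by (intro Min_le) auto
    \<comment> \<open>Lowering \<open>b\<close> by its least positive value \<open>m\<close> on the
      support removes at least one point from the support. The superlevel sets of \<open>b'\<close>
      are those of \<open>b\<close> with the threshold shifted by \<open>m\<close>, so the
      hypothesis on level sums is inherited.\<close>
    define b' where "b' e = (if 0 < b e then b e - m else 0)" for e
    have level: "{e. t < b' e} = {e. t + m < b e}" if "0 \<le> t" for t
      using that m_pos by (auto simp: b'_def)
    have "card {e. 0 < b' e} < card {e. 0 < b e}"
    proof (rule psubset_card_mono)
      obtain e where "b e = m" using m_in by auto
      then have "e \<notin> {e. 0 < b' e}" "e \<in> {e. 0 < b e}"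
        using m_pos by (simp_all add: b'_def)
      moreover have "{e. 0 < b' e} \<subseteq> {e. 0 < b e}" by (auto simp: b'_def)
      ultimately show "{e. 0 < b' e} \<subset> {e. 0 < b e}" by blast
    qed simp
    then have "0 \<le> (\<Sum>e\<in>UNIV. c e * b' e)"
      using less.hyps[of b'] less.prems(2) m_le m_pos level by (simp add: b'_def)
    moreover have "(\<Sum>e\<in>UNIV. c e * b e) = (\<Sum>e\<in>UNIV. c e * b' e) + m * (\<Sum>e | 0 < b e. c e)"
    proof -
      have "(\<Sum>e | 0 < b e. c e) = (\<Sum>e\<in>UNIV. if 0 < b e then c e else 0)"
        by (simp add: sum.If_cases)
      moreover have "c e * b e = c e * b' e + m * (if 0 < b e then c e else 0)" for e
        using less.prems(1)[of e] by (auto simp: b'_def algebra_simps)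
      ultimately show ?thesis
        by (simp add: sum.distrib sum_distrib_left)
    qed
    ultimately show ?thesis
      using less.prems(2)[of 0] m_pos by simp
  qed
qed

section \<open>Bases, exchange and duality of a matroid\<close>

context matroid
begin

lemma indep_finite: "indep A \<Longrightarrow> finite A"
  using finite_ground indep_in_ground finite_subset by blast

lemma finite_indep_sets: "finite {A. indep A}"
  using finite_ground indep_in_ground by (auto intro: finite_subset[of _ "Pow E"])

lemma card_le_matroid_rank: "indep A \<Longrightarrow> card A \<le> matroid_rank indep"
  unfolding matroid_rank_def using finite_indep_sets by (intro Max_ge) auto

lemma augment_to_card:
  assumes "indep I" "indep B" "card I \<le> card B"
  obtains J where "indep J" "I \<subseteq> J" "J \<subseteq> I \<union> B" "card J = card B"
  using assms
proof (induction "card B - card I" arbitrary: I thesis rule: less_induct)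
  case less
  show ?case
  proof (cases "card I = card B")
    case True
    then show ?thesis using less.prems(1)[of I] less.prems(2) by auto
  next
    case False
    with less.prems have lt: "card I < card B" by simp
    then obtain y where y: "y \<in> B - I" "indep (insert y I)"
      using augmentation less.prems by blast
    have card: "card (insert y I) = Suc (card I)"
      using y indep_finite[OF less.prems(2)] by simp
    have "card B - card (insert y I) < card B - card I" "card (insert y I) \<le> card B"
      using card lt by simp_all
    then obtain J where "indep J" "insert y I \<subseteq> J" "J \<subseteq> insert y I \<union> B" "card J = card B"
      using less.hyps[of "insert y I"] y(2) less.prems(3) by metis
    then show ?thesis using less.prems(1)[of J] y by auto
  qed
qed

lemma exists_indep_card_rank: "\<exists>B. indep B \<and> card B = matroid_rank indep"
proof -
  have "matroid_rank indep \<in> card ` {A. indep A}"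
    unfolding matroid_rank_def using finite_indep_sets indep_empty by (intro Max_in) auto
  then show ?thesis by auto
qed

lemma matroid_bases_eq: "matroid_bases indep = {B. indep B \<and> card B = matroid_rank indep}"
proof (intro Set.set_eqI iffI)
  fix B assume B: "B \<in> matroid_bases indep"
  obtain B' where B': "indep B'" "card B' = matroid_rank indep"
    using exists_indep_card_rank by blast
  have "indep B" "card B \<le> card B'"
    using B B' card_le_matroid_rank by (auto simp: matroid_bases_def)
  then obtain J where "indep J" "B \<subseteq> J" "card J = card B'"
    using augment_to_card B'(1) by metis
  then show "B \<in> {B. indep B \<and> card B = matroid_rank indep}"
    using B B' by (auto simp: matroid_bases_def)
next
  fix B assume B: "B \<in> {B. indep B \<and> card B = matroid_rank indep}"
  have "A = B" if "indep A" "B \<subseteq> A" for A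
    using card_seteq[OF indep_finite[OF that(1)] that(2)] card_le_matroid_rank[OF that(1)] B by simp
  then show "B \<in> matroid_bases indep"
    using B by (auto simp: matroid_bases_def)
qed

lemma matroid_bases_nonempty: "matroid_bases indep \<noteq> {}"
  using exists_indep_card_rank by (auto simp: matroid_bases_eq)

text \<open>The bound \<open>J \<subseteq> I \<union> B\<close> makes this an exchange property: the
  elements added to \<open>I\<close> can be drawn from a prescribed basis.\<close>

lemma extend_to_basis:
  assumes "indep I" "B \<in> matroid_bases indep"
  obtains J where "J \<in> matroid_bases indep" "I \<subseteq> J" "J \<subseteq> I \<union> B"
proof -
  have B: "indep B" "card B = matroid_rank indep"
    using assms(2) by (auto simp: matroid_bases_eq)
  obtain J where "indep J" "I \<subseteq> J" "J \<subseteq> I \<union> B" "card J = card B"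
    using augment_to_card assms(1) B card_le_matroid_rank by metis
  then show thesis using that B by (simp add: matroid_bases_eq)
qed

lemma matroid_bases_subset_eq:
  assumes "B \<in> matroid_bases indep" "B' \<in> matroid_bases indep" "B \<subseteq> B'"
  shows "B = B'"
  using assms by (auto simp: matroid_bases_def)

definition dual_indep :: "'e set \<Rightarrow> bool" where
  "dual_indep A \<longleftrightarrow> A \<subseteq> E \<and> (\<exists>B\<in>matroid_bases indep. A \<inter> B = {})"

lemma matroid_dual: "matroid E dual_indep"
proof
  fix A A' assume A: "dual_indep A" and A': "dual_indep A'" and less: "card A < card A'"
  obtain B where B: "B \<in> matroid_bases indep" "A \<inter> B = {}"
    using A by (auto simp: dual_indep_def)
  obtain B' where B': "B' \<in> matroid_bases indep" "A' \<inter> B' = {}"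
    using A' by (auto simp: dual_indep_def)
  have fin: "finite A" "finite A'" "finite B'"
    using A A' B' finite_subset[OF _ finite_ground] indep_finite
    unfolding dual_indep_def matroid_bases_eq by blast+
  have "indep (B' - A)"
    using B' indep_subset[of B'] by (auto simp: matroid_bases_eq)
  then obtain J where J: "J \<in> matroid_bases indep" "B' - A \<subseteq> J" "J \<subseteq> (B' - A) \<union> B"
    using extend_to_basis B(1) by blast
  have "finite J" using J indep_finite by (auto simp: matroid_bases_eq)
  \<comment> \<open>\<open>J\<close> avoids \<open>A\<close>, so any \<open>y\<close> in
    \<open>A' - A\<close> outside \<open>J\<close> can be added to \<open>A\<close>. If there were
    none, the basis \<open>J\<close> would contain the disjoint sets \<open>A' - A\<close> and
    \<open>B' - A\<close>. Comparing with \<open>card B'\<close> gives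
    \<open>card (A' - A) \<le> card (B' \<inter> A)\<close>, and since \<open>A'\<close> and
    \<open>B'\<close> are disjoint this forces \<open>card A' \<le> card A\<close>.\<close>
  have "\<not> A' - A \<subseteq> J"
  proof
    assume "A' - A \<subseteq> J"
    with J have "card ((A' - A) \<union> (B' - A)) \<le> card J"
      using \<open>finite J\<close> by (intro card_mono) auto
    moreover have "card ((A' - A) \<union> (B' - A)) = card (A' - A) + card (B' - A)"
      using fin B' by (intro card_Un_disjoint) auto
    moreover have "card J = card B'"
      using J B' by (auto simp: matroid_bases_eq)
    moreover have "card (B' - A) + card (B' \<inter> A) = card B'"
      using fin card_Diff_subset_Int[of B' A] card_mono[of B' "B' \<inter> A"] by simp
    moreover have "card (A' - A) + card (A' \<inter> A) = card A'"
      using fin card_Diff_subset_Int[of A' A] card_mono[of A' "A' \<inter> A"] by simp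
    moreover have "card (B' \<inter> A) + card (A' \<inter> A) \<le> card A"
    proof -
      have "card ((B' \<inter> A) \<union> (A' \<inter> A)) = card (B' \<inter> A) + card (A' \<inter> A)"
        using fin B' by (intro card_Un_disjoint) auto
      then show ?thesis using card_mono[of A "(B' \<inter> A) \<union> (A' \<inter> A)"] fin by auto
    qed
    ultimately show False using less by linarith
  qed
  then obtain y where "y \<in> A' - A" "y \<notin> J" by blast
  moreover have "insert y A \<inter> J = {}" using J B \<open>y \<notin> J\<close> by blast
  ultimately show "\<exists>y\<in>A' - A. dual_indep (insert y A)"
    using A A' J by (auto simp: dual_indep_def)
next
  show "dual_indep {}" using matroid_bases_nonempty by (auto simp: dual_indep_def)
next
  fix A A' assume "dual_indep A" "A' \<subseteq> A"
  then show "dual_indep A'" unfolding dual_indep_def by blast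
qed (use finite_ground in \<open>simp_all add: dual_indep_def\<close>)

lemma matroid_bases_dual: "matroid_bases dual_indep = (\<lambda>B. E - B) ` matroid_bases indep"
proof (intro Set.set_eqI iffI)
  fix A assume A: "A \<in> matroid_bases dual_indep"
  then obtain B where B: "B \<in> matroid_bases indep" "A \<inter> B = {}" "A \<subseteq> E"
    by (auto simp: matroid_bases_def dual_indep_def)
  then have "dual_indep (E - B)" by (auto simp: dual_indep_def)
  then have "A = E - B" using A B by (force simp: matroid_bases_def)
  then show "A \<in> (\<lambda>B. E - B) ` matroid_bases indep" using B by blast
next
  fix A assume "A \<in> (\<lambda>B. E - B) ` matroid_bases indep"
  then obtain B where B: "B \<in> matroid_bases indep" "A = E - B" by blast
  have "A' = A" if A': "dual_indep A'" "A \<subseteq> A'" for A'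
  proof -
    obtain B' where B': "B' \<in> matroid_bases indep" "A' \<inter> B' = {}" "A' \<subseteq> E"
      using A' by (auto simp: dual_indep_def)
    then have "B' \<subseteq> E" using indep_in_ground by (auto simp: matroid_bases_eq)
    then have "B' = B" using B B' A' by (intro matroid_bases_subset_eq) auto
    then show ?thesis using B B' A' by blast
  qed
  then show "A \<in> matroid_bases dual_indep"
    using B by (auto simp: matroid_bases_def dual_indep_def)
qed

lemma dependent_contains_circuit:
  assumes "A \<subseteq> E" "\<not> indep A"
  obtains C where "C \<in> matroid_circuits E indep" "C \<subseteq> A"
proof -
  have "finite A" using assms finite_ground finite_subset by blast
  then obtain C where C: "C \<subseteq> A" "\<not> indep C" "\<And>D. D \<subseteq> A \<Longrightarrow> \<not> indep D \<Longrightarrow> \<not> D \<subset> C"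
    using finite_has_minimal2[of "{C. C \<subseteq> A \<and> \<not> indep C}" A] assms by (auto simp: psubset_eq) metis
  then have "indep D" if "D \<subset> C" for D
    using that by (meson psubset_imp_subset subset_trans)
  then have "C \<in> matroid_circuits E indep"
    using assms C(1,2) by (auto simp: matroid_circuits_def)
  then show thesis using that C by blast
qed

text \<open>A basis of least weight is greedy: its elements of weight at most \<open>t\<close>
  already span all elements of weight at most \<open>t\<close>. Otherwise some \<open>y\<close>
  could be exchanged for a basis element \<open>z\<close>; all basis elements of weight at most
  \<open>t\<close> are kept, so \<open>z\<close> weighs more than \<open>t\<close> and the exchange
  lowers the total.\<close>

lemma min_weight_basis_meets_sublevel_sets:
  fixes b :: "'e \<Rightarrow> real"
  assumes B: "B \<in> matroid_bases indep"
    and min: "\<And>B'. B' \<in> matroid_bases indep \<Longrightarrow> sum b B \<le> sum b B'"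
    and y: "y \<notin> B" "b y \<le> t"
  shows "\<not> indep (insert y (B \<inter> {e. b e \<le> t}))"
proof
  assume "indep (insert y (B \<inter> {e. b e \<le> t}))"
  then obtain J where J: "J \<in> matroid_bases indep" "insert y (B \<inter> {e. b e \<le> t}) \<subseteq> J" "J \<subseteq> insert y B"
    by (rule extend_to_basis[OF _ B]) auto
  have fin: "finite B" "finite J" and card: "card J = card B"
    using B J indep_finite by (auto simp: matroid_bases_eq)
  obtain z where z: "z \<in> B" "z \<notin> J"
    using matroid_bases_subset_eq[OF B J(1)] J y by blast
  then have "J \<subseteq> insert y (B - {z})" using J by blast
  moreover have "card (insert y (B - {z})) = card J"
    using fin card y z card_Suc_Diff1[of B z] by simp
  ultimately have "J = insert y (B - {z})"
    using fin by (intro card_subset_eq) auto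
  then have "sum b J = b y + sum b B - b z"
    using fin y z by (simp add: sum_diff1)
  moreover have "t < b z" using z J by force
  ultimately show False using min[OF J(1)] y by simp
qed

end

section \<open>Transfer of blocking pairs between basis families\<close>

lemma finite_obtains_minimizer:
  fixes f :: "'a \<Rightarrow> real"
  assumes "finite S" "x \<in> S"
  obtains m where "m \<in> S" "\<forall>y\<in>S. f m \<le> f y"
proof (rule that)
  show "arg_min_on f S \<in> S" using assms by (intro arg_min_if_finite(1)) auto
  show "\<forall>y\<in>S. f (arg_min_on f S) \<le> f y" using assms by (auto intro: arg_min_least)
qed

text \<open>The set of all \<open>y\<close> outside \<open>I\<close> with \<open>insert y I\<close> independent is the complement of the flat
  spanned by \<open>I\<close>.\<close>

lemma exists_flat_bound:
  fixes indep :: "'e::finite set \<Rightarrow> bool" and a b :: "'e \<Rightarrow> real"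
  assumes "matroid UNIV indep" and a: "\<And>e. 0 \<le> a e" and b: "\<And>e. 0 \<le> b e"
    and bases: "\<And>B. B \<in> matroid_bases indep \<Longrightarrow> 1 \<le> sum b B"
  obtains I where "indep I" "card I < matroid_rank indep"
    "sum a {y. y \<notin> I \<and> indep (insert y I)} \<le>
       (real (matroid_rank indep) - real (card I)) * (\<Sum>e\<in>UNIV. a e * b e)"
proof -
  interpret matroid UNIV indep by fact
  define k where "k = matroid_rank indep"
  define Y where "Y I = {y. y \<notin> I \<and> indep (insert y I)}" for I
  \<comment> \<open>The set to be returned is the minimiser of this ratio over independent sets
    smaller than a basis. What remains is to show that the minimum \<open>q\<close> is at most the
    product of \<open>a\<close> and \<open>b\<close>.\<close>
  define g where "g I = sum a (Y I) / (real k - real (card I))" for I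
  have "{} \<notin> matroid_bases indep" using bases[of "{}"] by auto
  then have "0 < k" using indep_empty by (auto simp: matroid_bases_eq k_def)
  then have "{} \<in> {I. indep I \<and> card I < k}" using indep_empty by simp
  then obtain I where "I \<in> {I. indep I \<and> card I < k}" "\<forall>J\<in>{I. indep I \<and> card I < k}. g I \<le> g J"
    by (rule finite_obtains_minimizer[OF finite, of _ _ g])
  then have I: "indep I" "card I < k" "\<And>J. indep J \<Longrightarrow> card J < k \<Longrightarrow> g I \<le> g J"
    by simp_all
  define q where "q = g I"
  have "0 \<le> q" using I(2) a by (simp add: q_def g_def sum_nonneg)
  have q_le: "q * (real k - real (card J)) \<le> sum a (Y J)" if "indep J" for J
  proof (cases "card J < k")
    case True
    then show ?thesis using I(3)[OF that] by (simp add: q_def g_def[of J] pos_le_divide_eq)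
  next
    \<comment> \<open>For a basis the ratio \<open>g\<close> would divide by zero, but in product
      form the bound persists because its left side is zero.\<close>
    case False
    then have "card J = k" using card_le_matroid_rank[OF that] by (simp add: k_def)
    then show ?thesis using a by (simp add: sum_nonneg)
  qed
  obtain B0 where B0: "B0 \<in> matroid_bases indep" using matroid_bases_nonempty by blast
  obtain B where B: "B \<in> matroid_bases indep" "\<And>B'. B' \<in> matroid_bases indep \<Longrightarrow> sum b B \<le> sum b B'"
    by (rule finite_obtains_minimizer[OF finite B0, of "sum b"]) blast
  have "card B = k" "indep B" using B by (auto simp: matroid_bases_eq k_def)
  \<comment> \<open>With this \<open>c\<close>, nonnegativity of the sum of \<open>c e * b e\<close>
    says that \<open>q * sum b B\<close> is at most the product of \<open>a\<close> and
    \<open>b\<close>. The level sums of \<open>c\<close> are nonnegative because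
    \<open>B \<inter> ?F\<close> spans \<open>?F\<close>: everything outside its span lies in
    \<open>?G\<close>, and \<open>q_le\<close> bounds the \<open>a\<close>-weight there below by
    \<open>q\<close> times the number of elements of \<open>B\<close> in \<open>?G\<close>.\<close>
  define c where "c e = a e - (if e \<in> B then q else 0)" for e
  have "0 \<le> (\<Sum>e\<in>UNIV. c e * b e)"
  proof (rule sum_mult_nonneg_of_level_sums_nonneg[OF b])
    fix t :: real
    let ?F = "{e. b e \<le> t}" and ?G = "{e. t < b e}"
    have "Y (B \<inter> ?F) \<subseteq> ?G"
    proof
      fix y assume "y \<in> Y (B \<inter> ?F)"
      then show "y \<in> ?G"
        using min_weight_basis_meets_sublevel_sets[OF B, of y t] by (force simp: Y_def)
    qed
    then have "sum a (Y (B \<inter> ?F)) \<le> sum a ?G"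
      using a by (intro sum_mono2) auto
    moreover have "q * (real k - real (card (B \<inter> ?F))) \<le> sum a (Y (B \<inter> ?F))"
      using q_le indep_subset \<open>indep B\<close> by blast
    moreover have "card B = card (B \<inter> ?F) + card (B \<inter> ?G)"
      by (subst card_Un_disjoint[symmetric]) (auto intro: arg_cong[where f = card])
    moreover have "(\<Sum>e\<in>?G. c e) = sum a ?G - q * real (card (B \<inter> ?G))"
      by (simp add: c_def sum_subtractf sum.If_cases Int_commute)
    ultimately show "0 \<le> (\<Sum>e\<in>?G. c e)" using \<open>card B = k\<close> by simp
  qed
  also have "(\<Sum>e\<in>UNIV. c e * b e) = (\<Sum>e\<in>UNIV. a e * b e) - q * sum b B"
  proof -
    have "c e * b e = a e * b e - (if e \<in> B then q * b e else 0)" for e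
      by (simp add: c_def algebra_simps)
    then show ?thesis by (simp add: sum_subtractf sum.If_cases sum_distrib_left)
  qed
  finally have "q * sum b B \<le> (\<Sum>e\<in>UNIV. a e * b e)" by simp
  moreover have "q * 1 \<le> q * sum b B" using \<open>0 \<le> q\<close> bases[OF B(1)] by (intro mult_left_mono)
  ultimately have "q \<le> (\<Sum>e\<in>UNIV. a e * b e)" by simp
  then have "sum a (Y I) \<le> (real k - real (card I)) * (\<Sum>e\<in>UNIV. a e * b e)"
    using I(2) by (simp add: q_def g_def pos_divide_le_eq mult.commute)
  then show thesis using that[of I] I(1,2) by (simp add: k_def Y_def)
qed

lemma blocking_pair_bases_mono:
  fixes indep1 indep2 :: "'e::finite set \<Rightarrow> bool"
  assumes "matroid UNIV indep1" and "matroid UNIV indep2"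
    and sub: "matroid_bases indep1 \<subseteq> matroid_bases indep2"
    and ab: "blocking_pair (matroid_bases indep1) a b"
  obtains a' b' where "blocking_pair (matroid_bases indep2) a' b'"
    "(\<Sum>e\<in>UNIV. a' e * b' e) \<le> (\<Sum>e\<in>UNIV. a e * b e)"
proof -
  interpret M1: matroid UNIV indep1 by fact
  interpret M2: matroid UNIV indep2 by fact
  define k where "k = matroid_rank indep1"
  obtain B0 where "B0 \<in> matroid_bases indep1" using M1.matroid_bases_nonempty by blast
  then have k2: "k = matroid_rank indep2"
    using sub by (auto simp: M1.matroid_bases_eq M2.matroid_bases_eq k_def)
  have a: "\<And>e. 0 \<le> a e" and b: "\<And>e. 0 \<le> b e"
    and acov: "\<And>D. covers (matroid_bases indep1) D \<Longrightarrow> 1 \<le> sum a D"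
    and bcov: "\<And>B. B \<in> matroid_bases indep1 \<Longrightarrow> 1 \<le> sum b B"
    using ab by (auto simp: blocking_pair_def)
  obtain I where I: "indep1 I" "card I < k" and
    bound: "sum a {y. y \<notin> I \<and> indep1 (insert y I)} \<le> (real k - real (card I)) * (\<Sum>e\<in>UNIV. a e * b e)"
    unfolding k_def by (rule exists_flat_bound[of indep1 a b]) (use assms(1) a b bcov in auto)
  define Y where "Y = {y. y \<notin> I \<and> indep1 (insert y I)}"
  \<comment> \<open>Weight 1 on \<open>I\<close> settles every cover that meets \<open>I\<close> and
    costs nothing, since \<open>b'\<close> vanishes there. The remaining elements of the flat
    spanned by \<open>I\<close> get weight 0, so only \<open>Y\<close> contributes to the new
    product.\<close>
  define a' where "a' e = (if e \<in> I then 1 else if e \<in> Y then a e else 0)" for e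
  define b' where "b' e = (if e \<in> I then 0 else 1 / (real k - real (card I)))" for e
  have pos: "0 < real k - real (card I)" using I by simp
  have a'0: "0 \<le> a' e" and b'0: "0 \<le> b' e" for e using a I by (auto simp: a'_def b'_def)
  have "1 \<le> sum a' D" if D: "covers (matroid_bases indep2) D" for D
  proof (cases "D \<inter> I = {}")
    case True
    \<comment> \<open>Complete \<open>I\<close> to a basis \<open>J\<close> of the first matroid
      using elements of \<open>B\<close>. It is also a basis of the second, so \<open>D\<close>
      meets it, in some \<open>d\<close> outside \<open>I\<close>. Hence \<open>d\<close> lies in
      \<open>B\<close>, and \<open>insert d I \<subseteq> J\<close> shows
      \<open>d \<in> Y\<close>.\<close>
    have "covers (matroid_bases indep1) (D \<inter> Y)"
      unfolding covers_def
    proof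
      fix B assume B: "B \<in> matroid_bases indep1"
      then obtain J where J: "J \<in> matroid_bases indep1" "I \<subseteq> J" "J \<subseteq> I \<union> B"
        using M1.extend_to_basis I by blast
      then obtain d where d: "d \<in> J" "d \<in> D"
        using D sub J(1) unfolding covers_def by blast
      have "insert d I \<subseteq> J" using J d by blast
      then have "indep1 (insert d I)"
        using J M1.indep_subset[of J] by (auto simp: M1.matroid_bases_eq)
      then show "B \<inter> (D \<inter> Y) \<noteq> {}" using d J True by (auto simp: Y_def)
    qed
    then have "1 \<le> sum a (D \<inter> Y)" by (rule acov)
    also have "\<dots> = sum a' (D \<inter> Y)" using True by (intro sum.cong) (auto simp: a'_def)
    also have "\<dots> \<le> sum a' D" using a'0 by (intro sum_mono2) auto
    finally show ?thesis .
  next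
    case False
    then obtain d where d: "d \<in> D" "d \<in> I" by blast
    have "a' d \<le> sum a' D" using d a'0 by (intro member_le_sum) auto
    then show ?thesis using d by (simp add: a'_def)
  qed
  moreover have "1 \<le> sum b' B" if "B \<in> matroid_bases indep2" for B
  proof -
    have "card B = k" using that by (simp add: M2.matroid_bases_eq k2)
    then have "real k - real (card I) \<le> real (card (B - I))"
      using diff_card_le_card_Diff[of I B] by simp
    moreover have "sum b' B = real (card (B - I)) / (real k - real (card I))"
    proof -
      have "sum b' B = (\<Sum>e\<in>B - I. b' e)" by (intro sum.mono_neutral_right) (auto simp: b'_def)
      also have "\<dots> = (\<Sum>e\<in>B - I. 1 / (real k - real (card I)))" by (intro sum.cong) (auto simp: b'_def)
      finally show ?thesis by simp
    qed
    ultimately show ?thesis using pos by simp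
  qed
  ultimately have "blocking_pair (matroid_bases indep2) a' b'"
    using a'0 b'0 by (simp add: blocking_pair_def)
  moreover have "(\<Sum>e\<in>UNIV. a' e * b' e) \<le> (\<Sum>e\<in>UNIV. a e * b e)"
  proof -
    have "(\<Sum>e\<in>UNIV. a' e * b' e) = (\<Sum>e\<in>Y. a' e * b' e)"
      by (intro sum.mono_neutral_right) (auto simp: a'_def b'_def)
    also have "\<dots> = (\<Sum>e\<in>Y. a e / (real k - real (card I)))"
      by (intro sum.cong) (auto simp: a'_def b'_def Y_def)
    also have "\<dots> = sum a Y / (real k - real (card I))" by (simp add: sum_divide_distrib)
    also have "\<dots> \<le> (\<Sum>e\<in>UNIV. a e * b e)"
      using bound pos by (simp add: Y_def pos_divide_le_eq mult.commute)
    finally show ?thesis .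
  qed
  ultimately show thesis by (rule that)
qed

section \<open>Circuits through the dual matroid\<close>

lemma (in matroid) covers_circuits_iff:
  assumes "E = UNIV"
  shows "covers (matroid_circuits E indep) D \<longleftrightarrow> indep (- D)"
proof
  assume D: "covers (matroid_circuits E indep) D"
  show "indep (- D)"
  proof (rule ccontr)
    assume "\<not> indep (- D)"
    then obtain C where "C \<in> matroid_circuits E indep" "C \<subseteq> - D"
      using dependent_contains_circuit assms by blast
    then show False using D by (auto simp: covers_def)
  qed
next
  assume "indep (- D)"
  then show "covers (matroid_circuits E indep) D"
    using indep_subset[of "- D"] by (auto simp: covers_def matroid_circuits_def disjoint_eq_subset_Compl)
qed

lemma (in matroid) covers_bases_dual_iff:
  assumes "E = UNIV"
  shows "covers (matroid_bases dual_indep) D \<longleftrightarrow> \<not> indep D"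
proof
  assume D: "covers (matroid_bases dual_indep) D"
  show "\<not> indep D"
  proof
    assume "indep D"
    then obtain B where "B \<in> matroid_bases indep" "D \<subseteq> B"
      using extend_to_basis matroid_bases_nonempty by blast
    then show False using D by (auto simp: covers_def matroid_bases_dual)
  qed
next
  assume D: "\<not> indep D"
  have "(E - B) \<inter> D \<noteq> {}" if "B \<in> matroid_bases indep" for B
    using that D indep_subset[of B D] assms by (auto simp: matroid_bases_eq)
  then show "covers (matroid_bases dual_indep) D"
    by (auto simp: covers_def matroid_bases_dual)
qed

text \<open>The covers of the circuits are the supersets of complements of bases, so the cover
  condition on \<open>a\<close> can be tested on the bases of the dual. The covers of the dual bases
  are the dependent sets, so the cover condition for the dual can be tested on circuits. Thus
  \<open>a\<close> and \<open>b\<close> exchange roles.\<close>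

lemma blocking_pair_circuits_iff:
  fixes indep :: "'e::finite set \<Rightarrow> bool"
  assumes "matroid UNIV indep"
  shows "blocking_pair (matroid_circuits UNIV indep) a b \<longleftrightarrow>
    blocking_pair (matroid_bases (matroid.dual_indep UNIV indep)) b a"
proof -
  interpret matroid UNIV indep by fact
  have A: "(\<forall>D. indep (- D) \<longrightarrow> 1 \<le> sum a D) \<longleftrightarrow> (\<forall>U\<in>matroid_bases dual_indep. 1 \<le> sum a U)"
    if a: "\<forall>e. 0 \<le> a e"
  proof (intro iffI ballI allI impI)
    fix U assume *: "\<forall>D. indep (- D) \<longrightarrow> 1 \<le> sum a D" and "U \<in> matroid_bases dual_indep"
    then show "1 \<le> sum a U" by (auto simp: matroid_bases_dual matroid_bases_eq Compl_eq_Diff_UNIV[symmetric])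
  next
    fix D assume *: "\<forall>U\<in>matroid_bases dual_indep. 1 \<le> sum a U" and "indep (- D)"
    then obtain B where B: "B \<in> matroid_bases indep" "- D \<subseteq> B"
      using extend_to_basis matroid_bases_nonempty by blast
    then have "1 \<le> sum a (UNIV - B)" using * by (auto simp: matroid_bases_dual)
    also have "\<dots> \<le> sum a D" using B a by (intro sum_mono2) auto
    finally show "1 \<le> sum a D" .
  qed
  have B: "(\<forall>U\<in>matroid_circuits UNIV indep. 1 \<le> sum b U) \<longleftrightarrow> (\<forall>D. \<not> indep D \<longrightarrow> 1 \<le> sum b D)"
    if b: "\<forall>e. 0 \<le> b e"
  proof (intro iffI ballI allI impI)
    fix D assume *: "\<forall>U\<in>matroid_circuits UNIV indep. 1 \<le> sum b U" and "\<not> indep D"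
    then obtain C where C: "C \<in> matroid_circuits UNIV indep" "C \<subseteq> D"
      using dependent_contains_circuit by blast
    then have "1 \<le> sum b C" using * by blast
    also have "\<dots> \<le> sum b D" using C b by (intro sum_mono2) auto
    finally show "1 \<le> sum b D" .
  qed (auto simp: matroid_circuits_def)
  show ?thesis
    unfolding blocking_pair_def using A B
    by (auto simp: covers_circuits_iff covers_bases_dual_iff)
qed

text \<open>Taking complements preserves the inclusion of basis families, so the basis case applies
  to the duals in the same direction. The product is symmetric in \<open>a\<close> and
  \<open>b\<close>.\<close>

lemma blocking_pair_circuits_mono:
  fixes indep1 indep2 :: "'e::finite set \<Rightarrow> bool"
  assumes "matroid UNIV indep1" and "matroid UNIV indep2"
    and "matroid_bases indep1 \<subseteq> matroid_bases indep2"
    and "blocking_pair (matroid_circuits UNIV indep1) a b"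
  obtains a' b' where "blocking_pair (matroid_circuits UNIV indep2) a' b'"
    "(\<Sum>e\<in>UNIV. a' e * b' e) \<le> (\<Sum>e\<in>UNIV. a e * b e)"
proof -
  let ?d1 = "matroid.dual_indep UNIV indep1" and ?d2 = "matroid.dual_indep UNIV indep2"
  have "matroid UNIV ?d1" "matroid UNIV ?d2"
    using assms(1,2) by (simp_all add: matroid.matroid_dual)
  moreover have "matroid_bases ?d1 \<subseteq> matroid_bases ?d2"
    using assms(3) by (auto simp: matroid.matroid_bases_dual[OF assms(1)] matroid.matroid_bases_dual[OF assms(2)])
  moreover have "blocking_pair (matroid_bases ?d1) b a"
    using assms(4) by (simp add: blocking_pair_circuits_iff[OF assms(1)])
  ultimately obtain b' a' where "blocking_pair (matroid_bases ?d2) b' a'"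
    "(\<Sum>e\<in>UNIV. b' e * a' e) \<le> (\<Sum>e\<in>UNIV. b e * a e)"
    by (rule blocking_pair_bases_mono)
  then show thesis
    using that[of a' b'] by (simp add: blocking_pair_circuits_iff[OF assms(2)] mult.commute)
qed


section \<open>Powers of monomial ideals\<close>

lemma mpoly_ring_simps [simp]:
  "carrier mpoly_ring = UNIV" "monoid.mult mpoly_ring = (*)" "ring.add mpoly_ring = (+)"
  "monoid.one mpoly_ring = 1" "ring.zero mpoly_ring = 0"
  by (simp_all add: mpoly_ring_def ring_of_type_algebra_def)

lemma ring_mpoly_ring: "ring mpoly_ring"
  using cring_mpoly_ring by (rule cring.axioms(1))

lemma ideal_mpoly_ringI:
  fixes I :: "('e::finite, 'k::field) mpoly set"
  assumes "0 \<in> I" and "\<And>f g. f \<in> I \<Longrightarrow> g \<in> I \<Longrightarrow> f + g \<in> I" and "\<And>c f. f \<in> I \<Longrightarrow> c * f \<in> I"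
  shows "ideal I mpoly_ring"
proof (rule idealI[OF ring_mpoly_ring])
  show "subgroup I (add_monoid mpoly_ring)"
  proof (rule group.subgroupI)
    show "Group.group (add_monoid (mpoly_ring :: ('e, 'k) mpoly ring))"
      using abelian_group.a_group[OF ring.is_abelian_group[OF ring_mpoly_ring]] .
    fix f assume "f \<in> I"
    have "inv\<^bsub>add_monoid mpoly_ring\<^esub> f = - f"
      by (rule group.inv_equality[OF abelian_group.a_group[OF ring.is_abelian_group[OF ring_mpoly_ring]]]) simp_all
    then show "inv\<^bsub>add_monoid mpoly_ring\<^esub> f \<in> I"
      using assms(3)[OF \<open>f \<in> I\<close>, of "- 1"] by simp
  qed (use assms in auto)
qed (use assms in \<open>auto simp: mult.commute\<close>)

lemma ideal_mpoly_ringD: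
  assumes "ideal I (mpoly_ring :: ('e::finite, 'k::field) mpoly ring)"
  shows "0 \<in> I" and "f \<in> I \<Longrightarrow> g \<in> I \<Longrightarrow> f + g \<in> I" and "f \<in> I \<Longrightarrow> c * f \<in> I"
  using additive_subgroup.zero_closed[OF ideal.axioms(1)[OF assms]]
    additive_subgroup.a_closed[OF ideal.axioms(1)[OF assms], of f g]
    ideal.I_l_closed[OF assms, of f c] by simp_all

lemma ideal_mpoly_ring_sum:
  assumes "ideal I (mpoly_ring :: ('e::finite, 'k::field) mpoly ring)" and "\<And>x. x \<in> S \<Longrightarrow> f x \<in> I"
  shows "sum f S \<in> I"
  using assms(2) by (induction S rule: infinite_finite_induct) (auto intro: ideal_mpoly_ringD[OF assms(1)])

lemma poly_mapping_eq_sum_single: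
  "f = (\<Sum>w\<in>Poly_Mapping.keys f. Poly_Mapping.single w (Poly_Mapping.lookup f w))"
  by (rule poly_mapping_eqI) (auto simp: lookup_sum lookup_single when_def in_keys_iff)

lemma ideal_mpoly_ring_mem:
  fixes f :: "('e::finite, 'k::field) mpoly"
  assumes "ideal I mpoly_ring"
    and "\<And>w. w \<in> Poly_Mapping.keys f \<Longrightarrow> Poly_Mapping.single w 1 \<in> I"
  shows "f \<in> I"
proof -
  have "Poly_Mapping.single w (Poly_Mapping.lookup f w) \<in> I" if "w \<in> Poly_Mapping.keys f" for w
    using ideal_mpoly_ringD(3)[OF assms(1) assms(2)[OF that], of "Poly_Mapping.single 0 (Poly_Mapping.lookup f w)"]
    by (simp add: mult_single)
  then show ?thesis
    using ideal_mpoly_ring_sum[OF assms(1)] poly_mapping_eq_sum_single[of f] by metis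
qed

section \<open>Monomial ideals described by their exponents\<close>

definition upclosed :: "('e \<Rightarrow>\<^sub>0 nat) set \<Rightarrow> bool" where
  "upclosed W \<longleftrightarrow> (\<forall>w\<in>W. \<forall>v. w + v \<in> W)"

definition monomial_ideal :: "('e \<Rightarrow>\<^sub>0 nat) set \<Rightarrow> ('e, 'k::field) mpoly set" where
  "monomial_ideal W = {f. Poly_Mapping.keys f \<subseteq> W}"

lemma single_mem_monomial_ideal [simp]:
  "Poly_Mapping.single w 1 \<in> (monomial_ideal W :: ('e, 'k::field) mpoly set) \<longleftrightarrow> w \<in> W"
  by (simp add: monomial_ideal_def)

lemma ideal_monomial_ideal:
  assumes "upclosed W"
  shows "ideal (monomial_ideal W :: ('e::finite, 'k::field) mpoly set) mpoly_ring"
proof (rule ideal_mpoly_ringI)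
  fix f g :: "('e, 'k) mpoly" assume "f \<in> monomial_ideal W" "g \<in> monomial_ideal W"
  then show "f + g \<in> monomial_ideal W"
    using keys_add[of f g] by (auto simp: monomial_ideal_def)
next
  fix c f :: "('e, 'k) mpoly" assume "f \<in> monomial_ideal W"
  then show "c * f \<in> monomial_ideal W"
    using keys_mult[of c f] assms by (fastforce simp: monomial_ideal_def upclosed_def add.commute)
qed (simp add: monomial_ideal_def)

lemma monomial_ideal_subset_iff:
  assumes "ideal I (mpoly_ring :: ('e::finite, 'k::field) mpoly ring)"
  shows "monomial_ideal W \<subseteq> I \<longleftrightarrow> (\<forall>w\<in>W. Poly_Mapping.single w 1 \<in> I)"
proof
  assume "monomial_ideal W \<subseteq> I"
  then show "\<forall>w\<in>W. Poly_Mapping.single w 1 \<in> I"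
    using single_mem_monomial_ideal by blast
next
  assume *: "\<forall>w\<in>W. Poly_Mapping.single w 1 \<in> I"
  show "monomial_ideal W \<subseteq> I"
  proof
    fix f :: "('e, 'k) mpoly" assume "f \<in> monomial_ideal W"
    then have "Poly_Mapping.single w 1 \<in> I" if "w \<in> Poly_Mapping.keys f" for w
      using * that by (auto simp: monomial_ideal_def)
    then show "f \<in> I" by (rule ideal_mpoly_ring_mem[OF assms])
  qed
qed

definition exponent_sums :: "('e \<Rightarrow>\<^sub>0 nat) set \<Rightarrow> ('e \<Rightarrow>\<^sub>0 nat) set \<Rightarrow> ('e \<Rightarrow>\<^sub>0 nat) set" where
  "exponent_sums V W = {v + w | v w. v \<in> V \<and> w \<in> W}"

text \<open>The zeroth power is everything, matching the zeroth power of an ideal, which is the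
  whole ring. Since the powers start from \<open>UNIV\<close>, they contain all multiples of the
  products of elements of \<open>W\<close>.\<close>

fun exponent_power :: "('e \<Rightarrow>\<^sub>0 nat) set \<Rightarrow> nat \<Rightarrow> ('e \<Rightarrow>\<^sub>0 nat) set" where
  "exponent_power W 0 = UNIV"
| "exponent_power W (Suc n) = exponent_sums (exponent_power W n) W"

lemma upclosed_exponent_sums: "upclosed W \<Longrightarrow> upclosed (exponent_sums V W)"
  unfolding upclosed_def exponent_sums_def by (auto simp: add.assoc) blast

lemma upclosed_exponent_power: "upclosed W \<Longrightarrow> upclosed (exponent_power W n)"
  by (cases n) (simp_all add: upclosed_exponent_sums, simp add: upclosed_def)

lemma ideal_prod_monomial_ideal:
  fixes V W :: "('e::finite \<Rightarrow>\<^sub>0 nat) set"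
  assumes "upclosed V" "upclosed W"
  shows "ideal_prod (mpoly_ring :: ('e, 'k::field) mpoly ring) (monomial_ideal V) (monomial_ideal W)
    = monomial_ideal (exponent_sums V W)" (is "?L = ?R")
proof
  show "?L \<subseteq> ?R"
  proof
    fix f assume "f \<in> ?L"
    then show "f \<in> ?R"
    proof induction
      case (prod i j)
      then show ?case
        using keys_mult[of i j] unfolding monomial_ideal_def exponent_sums_def by force
    next
      case (sum f g)
      then show ?case using keys_add[of f g] by (auto simp: monomial_ideal_def)
    qed
  qed
  have I: "ideal ?L (mpoly_ring :: ('e, 'k) mpoly ring)"
    by (intro ring.ideal_prod_is_ideal ring_mpoly_ring ideal_monomial_ideal assms)
  have "Poly_Mapping.single (v + w) 1 \<in> ?L" if "v \<in> V" "w \<in> W" for v w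
    using ideal_prod.prod[of "Poly_Mapping.single v 1" "monomial_ideal V :: ('e, 'k) mpoly set"
        "Poly_Mapping.single w 1" "monomial_ideal W" mpoly_ring] that
    by (simp add: mult_single)
  then show "?R \<subseteq> ?L"
    unfolding monomial_ideal_subset_iff[OF I] by (auto simp: exponent_sums_def)
qed

lemma ideal_power_0: "ideal_power R I 0 = carrier R"
  and ideal_power_Suc: "ideal_power R I (Suc n) = ideal_prod R (ideal_power R I n) I"
  unfolding ideal_power_def nat_pow_def by (simp_all, simp_all add: ideals_set_def)

lemma ideal_power_mono: "I \<subseteq> J \<Longrightarrow> ideal_power R I n \<subseteq> ideal_power R J n"
proof (induction n)
  case (Suc n)
  show ?case
  proof
    fix f assume "f \<in> ideal_power R I (Suc n)"
    then show "f \<in> ideal_power R J (Suc n)"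
      unfolding ideal_power_Suc
    proof induction
      case (prod i j)
      then show ?case using Suc by (intro ideal_prod.prod) blast+
    qed (rule ideal_prod.sum)
  qed
qed (simp add: ideal_power_0)

lemma ideal_power_monomial_ideal:
  fixes W :: "('e::finite \<Rightarrow>\<^sub>0 nat) set"
  assumes "upclosed W"
  shows "ideal_power (mpoly_ring :: ('e, 'k::field) mpoly ring) (monomial_ideal W) n
    = monomial_ideal (exponent_power W n)"
proof (induction n)
  case 0
  show ?case by (simp add: ideal_power_0 monomial_ideal_def)
next
  case (Suc n)
  then show ?case
    by (simp add: ideal_power_Suc ideal_prod_monomial_ideal upclosed_exponent_power assms)
qed

section \<open>Ideals generated by squarefree monomials\<close>

definition indicator_exponent :: "'e set \<Rightarrow> ('e::finite \<Rightarrow>\<^sub>0 nat)" where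
  "indicator_exponent U = (\<Sum>e\<in>U. Poly_Mapping.single e 1)"

lemma lookup_indicator_exponent:
  "Poly_Mapping.lookup (indicator_exponent U) e = (if e \<in> U then 1 else 0)"
  by (simp add: indicator_exponent_def lookup_sum lookup_single when_def)

lemma squarefree_monomial_eq:
  "squarefree_monomial U = (Poly_Mapping.single (indicator_exponent U) 1 :: ('e::finite, 'k::field) mpoly)"
proof -
  have "finite U" by simp
  then show ?thesis
    by (induction U) (simp_all add: squarefree_monomial_def indicator_exponent_def mpoly_var_def mult_single)
qed

definition divisible_exponents :: "'e set set \<Rightarrow> ('e \<Rightarrow>\<^sub>0 nat) set" where
  "divisible_exponents \<A> = {w. \<exists>U\<in>\<A>. \<forall>e\<in>U. 1 \<le> Poly_Mapping.lookup w e}"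

lemma upclosed_divisible_exponents: "upclosed (divisible_exponents \<A>)"
  unfolding upclosed_def divisible_exponents_def by (fastforce simp: lookup_add)

lemma divisible_exponentsE:
  fixes w :: "'e::finite \<Rightarrow>\<^sub>0 nat"
  assumes "w \<in> divisible_exponents \<A>"
  obtains U v where "U \<in> \<A>" "w = v + indicator_exponent U"
proof -
  obtain U where U: "U \<in> \<A>" "\<And>e. e \<in> U \<Longrightarrow> 1 \<le> Poly_Mapping.lookup w e"
    using assms by (auto simp: divisible_exponents_def)
  have "w = (w - indicator_exponent U) + indicator_exponent U"
    using U(2) by (intro poly_mapping_eqI) (auto simp: lookup_add lookup_minus lookup_indicator_exponent)
  then show thesis using that U(1) by blast
qed

lemma indicator_exponent_mem: "U \<in> \<A> \<Longrightarrow> indicator_exponent U \<in> divisible_exponents \<A>"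
  by (auto simp: divisible_exponents_def lookup_indicator_exponent)

text \<open>From here on both ideals of a matroid are handled through exponent vectors alone, so the
  coefficient field drops out of the arguments about powers.\<close>

lemma genideal_squarefree_monomials:
  "Idl\<^bsub>mpoly_ring\<^esub> (squarefree_monomial ` \<A>) =
    (monomial_ideal (divisible_exponents \<A>) :: ('e::finite, 'k::field) mpoly set)" (is "?L = ?R")
proof
  show "?L \<subseteq> ?R"
    by (intro ring.genideal_minimal ring_mpoly_ring ideal_monomial_ideal upclosed_divisible_exponents)
      (auto simp: squarefree_monomial_eq indicator_exponent_mem)
  have I: "ideal ?L mpoly_ring"
    by (intro ring.genideal_ideal ring_mpoly_ring) simp
  have "Poly_Mapping.single w 1 \<in> ?L" if w: "w \<in> divisible_exponents \<A>" for w
  proof -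
    obtain U v where U: "U \<in> \<A>" "w = v + indicator_exponent U"
      using w by (rule divisible_exponentsE)
    have "squarefree_monomial ` \<A> \<subseteq> ?L"
      by (intro ring.genideal_self ring_mpoly_ring) simp
    then have "squarefree_monomial U \<in> ?L" using U(1) by blast
    then have "Poly_Mapping.single (indicator_exponent U) 1 \<in> ?L"
      by (simp only: squarefree_monomial_eq[of U])
    then have "Poly_Mapping.single v 1 * Poly_Mapping.single (indicator_exponent U) 1 \<in> ?L"
      by (rule ideal_mpoly_ringD(3)[OF I])
    then show ?thesis using U(2) by (simp add: mult_single)
  qed
  then show "?R \<subseteq> ?L" by (simp add: monomial_ideal_subset_iff[OF I])
qed

text \<open>Each of the \<open>n\<close> factors is divisible by some generator and so contributes
  \<open>b\<close>-weight at least 1. The bound serves as a certificate that a monomial is not in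
  the power.\<close>

lemma weight_ge_of_mem_exponent_power:
  fixes b :: "'e::finite \<Rightarrow> real"
  assumes "w \<in> exponent_power (divisible_exponents \<A>) n"
    and b: "\<And>e. 0 \<le> b e" and cover: "\<And>U. U \<in> \<A> \<Longrightarrow> 1 \<le> sum b U"
  shows "real n \<le> (\<Sum>e\<in>UNIV. b e * real (Poly_Mapping.lookup w e))"
  using assms(1)
proof (induction n arbitrary: w)
  case 0
  show ?case using b by (simp add: sum_nonneg)
next
  case (Suc n)
  then obtain v u where v: "v \<in> exponent_power (divisible_exponents \<A>) n"
    and u: "u \<in> divisible_exponents \<A>" and w: "w = v + u"
    by (auto simp: exponent_sums_def)
  obtain U x where U: "U \<in> \<A>" "u = x + indicator_exponent U"
    using u by (rule divisible_exponentsE)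
  have "b e * real (Poly_Mapping.lookup v e) + (if e \<in> U then b e else 0)
      \<le> b e * real (Poly_Mapping.lookup w e)" for e
    using b[of e] by (simp add: w U lookup_add lookup_indicator_exponent algebra_simps)
  then have "(\<Sum>e\<in>UNIV. b e * real (Poly_Mapping.lookup v e) + (if e \<in> U then b e else 0))
      \<le> (\<Sum>e\<in>UNIV. b e * real (Poly_Mapping.lookup w e))"
    by (rule sum_mono)
  then have "(\<Sum>e\<in>UNIV. b e * real (Poly_Mapping.lookup v e)) + sum b U
      \<le> (\<Sum>e\<in>UNIV. b e * real (Poly_Mapping.lookup w e))"
    by (simp add: sum.distrib sum.If_cases)
  then show ?case using Suc.IH[OF v] cover[OF U(1)] by simp
qed

text \<open>Taking each generator \<open>U\<close> with multiplicity \<open>m U\<close> gives a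
  product of at least \<open>n\<close> generators that divides the monomial with exponent
  \<open>w\<close>. The induction splits off one generator at a time.\<close>

lemma mem_exponent_power_of_packing:
  fixes m :: "'e::finite set \<Rightarrow> nat"
  assumes "n \<le> sum m \<A>" and "\<And>e. sum m {U \<in> \<A>. e \<in> U} \<le> Poly_Mapping.lookup w e"
  shows "w \<in> exponent_power (divisible_exponents \<A>) n"
  using assms
proof (induction n arbitrary: m w)
  case (Suc n)
  have "sum m \<A> \<noteq> 0" using Suc.prems(1) by linarith
  then obtain U where U: "U \<in> \<A>" "0 < m U"
    by (auto simp: sum_eq_0_iff)
  define m' where "m' = m(U := m U - 1)"
  \<comment> \<open>Stated for arbitrary families because it is applied both to the whole family and
    to the members through a fixed \<open>e\<close>.\<close>
  have dec: "sum m \<B> = sum m' \<B> + (if U \<in> \<B> then 1 else 0)" for \<B>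
  proof (cases "U \<in> \<B>")
    case True
    then have "sum m \<B> = m U + sum m (\<B> - {U})" "sum m' \<B> = m' U + sum m' (\<B> - {U})"
      by (simp_all add: sum.remove)
    moreover have "sum m (\<B> - {U}) = sum m' (\<B> - {U})"
      by (intro sum.cong) (auto simp: m'_def)
    moreover have "m U = m' U + 1" using U by (simp add: m'_def)
    ultimately show ?thesis using True by simp
  next
    case False
    then have "sum m \<B> = sum m' \<B>" by (intro sum.cong) (auto simp: m'_def)
    then show ?thesis using False by simp
  qed
  define v where "v = w - indicator_exponent U"
  have le: "sum m' {V \<in> \<A>. e \<in> V} + (if e \<in> U then 1 else 0) \<le> Poly_Mapping.lookup w e" for e
    using Suc.prems(2)[of e] dec[of "{V \<in> \<A>. e \<in> V}"] U by simp
  have "v \<in> exponent_power (divisible_exponents \<A>) n"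
  proof (rule Suc.IH)
    show "n \<le> sum m' \<A>" using Suc.prems(1) dec[of \<A>] U by simp
    show "sum m' {V \<in> \<A>. e \<in> V} \<le> Poly_Mapping.lookup v e" for e
      using le[of e] by (auto simp: v_def lookup_minus lookup_indicator_exponent split: if_splits)
  qed
  moreover have "w = v + indicator_exponent U"
  proof (rule poly_mapping_eqI)
    show "Poly_Mapping.lookup w e = Poly_Mapping.lookup (v + indicator_exponent U) e" for e
      using le[of e] by (auto simp: v_def lookup_add lookup_minus lookup_indicator_exponent split: if_splits)
  qed
  ultimately show ?case
    using indicator_exponent_mem[OF U(1)] by (auto simp: exponent_sums_def)
qed simp

section \<open>Symbolic powers of squarefree monomial ideals\<close>

text \<open>The ideal generated by the variables in \<open>C\<close>, written with singletons as the
  family so that the results on powers of squarefree monomial ideals apply to it.\<close>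

definition variables_ideal :: "'e set \<Rightarrow> ('e, 'k::field) mpoly set" where
  "variables_ideal C = monomial_ideal (divisible_exponents ((\<lambda>e. {e}) ` C))"

text \<open>One direction is the weight bound with \<open>b\<close> the indicator of
  \<open>C\<close>. The other is the packing that uses each singleton as often as its variable
  occurs in \<open>w\<close>.\<close>

lemma mem_exponent_power_variables_iff:
  fixes w :: "'e::finite \<Rightarrow>\<^sub>0 nat"
  shows "w \<in> exponent_power (divisible_exponents ((\<lambda>e. {e}) ` C)) n \<longleftrightarrow> n \<le> sum (Poly_Mapping.lookup w) C"
proof
  assume "w \<in> exponent_power (divisible_exponents ((\<lambda>e. {e}) ` C)) n"
  then have "real n \<le> (\<Sum>e\<in>UNIV. (if e \<in> C then 1 else 0) * real (Poly_Mapping.lookup w e))"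
    by (rule weight_ge_of_mem_exponent_power) auto
  also have "\<dots> = (\<Sum>e\<in>UNIV. if e \<in> C then real (Poly_Mapping.lookup w e) else 0)"
    by (intro sum.cong) auto
  also have "\<dots> = real (sum (Poly_Mapping.lookup w) C)" by (simp add: sum.If_cases)
  finally show "n \<le> sum (Poly_Mapping.lookup w) C" by (simp only: of_nat_le_iff)
next
  assume n: "n \<le> sum (Poly_Mapping.lookup w) C"
  define m where "m U = sum (Poly_Mapping.lookup w) U" for U
  show "w \<in> exponent_power (divisible_exponents ((\<lambda>e. {e}) ` C)) n"
  proof (rule mem_exponent_power_of_packing)
    show "n \<le> sum m ((\<lambda>e. {e}) ` C)"
      using n by (simp add: m_def sum.reindex)
    fix e
    have "sum m {U \<in> (\<lambda>e. {e}) ` C. e \<in> U} \<le> sum m {{e}}"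
      by (intro sum_mono2) auto
    then show "sum m {U \<in> (\<lambda>e. {e}) ` C. e \<in> U} \<le> Poly_Mapping.lookup w e"
      by (simp add: m_def)
  qed
qed

lemma ideal_power_variables_ideal:
  "ideal_power mpoly_ring (variables_ideal C :: ('e::finite, 'k::field) mpoly set) n =
    {f. \<forall>w\<in>Poly_Mapping.keys f. n \<le> sum (Poly_Mapping.lookup w) C}"
  unfolding variables_ideal_def ideal_power_monomial_ideal[OF upclosed_divisible_exponents]
  by (auto simp: monomial_ideal_def mem_exponent_power_variables_iff)

lemma mem_variables_ideal_iff:
  "f \<in> variables_ideal C \<longleftrightarrow> (\<forall>w\<in>Poly_Mapping.keys f. \<exists>e\<in>C. 0 < Poly_Mapping.lookup w e)"
  by (auto simp: variables_ideal_def monomial_ideal_def divisible_exponents_def Suc_le_eq)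

lemma mpoly_var_mem_variables_ideal_iff [simp]: "mpoly_var e \<in> variables_ideal C \<longleftrightarrow> e \<in> C"
  by (auto simp: mem_variables_ideal_iff mpoly_var_def lookup_single when_def split: if_splits)

text \<open>This replaces leading monomials: exponent vectors over an unordered set of variables carry no
  monomial order. The coordinates are maximised one after the other.\<close>

lemma obtains_uniquely_represented_sum:
  fixes S T :: "('e::finite \<Rightarrow>\<^sub>0 nat) set"
  assumes "finite S" "finite T" "S \<noteq> {}" "T \<noteq> {}"
  obtains u v where "u \<in> S" "v \<in> T"
    "\<And>u' v'. u' \<in> S \<Longrightarrow> v' \<in> T \<Longrightarrow> u' + v' = u + v \<Longrightarrow> u' = u \<and> v' = v"
proof -
  let ?top = "\<lambda>e R. {u \<in> R. \<forall>u'\<in>R. Poly_Mapping.lookup u' e \<le> Poly_Mapping.lookup u e}"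
  have top: "?top e R \<noteq> {}" if "finite R" "R \<noteq> {}" for e and R :: "('e \<Rightarrow>\<^sub>0 nat) set"
  proof -
    have "Max ((\<lambda>u. Poly_Mapping.lookup u e) ` R) \<in> (\<lambda>u. Poly_Mapping.lookup u e) ` R"
      using that by (intro Max_in) auto
    then obtain u where "u \<in> R" "Poly_Mapping.lookup u e = Max ((\<lambda>u. Poly_Mapping.lookup u e) ` R)"
      by auto
    then have "u \<in> ?top e R" using that by (auto intro: Max_ge)
    then show ?thesis by blast
  qed
  \<comment> \<open>The invariant keeps subsets that are constant on the coordinates in
    \<open>F\<close> and closed under other representations of their sums. When coordinate
    \<open>e\<close> is maximised in both subsets, two entries whose sum equals the sum of the
    maxima must both be maximal, so the closure survives.\<close>
  have "\<exists>S' T'. S' \<subseteq> S \<and> T' \<subseteq> T \<and> S' \<noteq> {} \<and> T' \<noteq> {} \<and>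
      (\<forall>u\<in>S'. \<forall>u'\<in>S'. \<forall>e\<in>F. Poly_Mapping.lookup u e = Poly_Mapping.lookup u' e) \<and>
      (\<forall>v\<in>T'. \<forall>v'\<in>T'. \<forall>e\<in>F. Poly_Mapping.lookup v e = Poly_Mapping.lookup v' e) \<and>
      (\<forall>u\<in>S'. \<forall>v\<in>T'. \<forall>u'\<in>S. \<forall>v'\<in>T. u' + v' = u + v \<longrightarrow> u' \<in> S' \<and> v' \<in> T')"
    if "finite F" for F :: "'e set"
    using that
  proof (induction F)
    case empty
    show ?case using assms by (intro exI[of _ S] exI[of _ T]) auto
  next
    case (insert e F)
    then obtain S' T' where sub: "S' \<subseteq> S" "T' \<subseteq> T" and ne: "S' \<noteq> {}" "T' \<noteq> {}"
      and const: "\<forall>u\<in>S'. \<forall>u'\<in>S'. \<forall>e\<in>F. Poly_Mapping.lookup u e = Poly_Mapping.lookup u' e"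
        "\<forall>v\<in>T'. \<forall>v'\<in>T'. \<forall>e\<in>F. Poly_Mapping.lookup v e = Poly_Mapping.lookup v' e"
      and rep: "\<forall>u\<in>S'. \<forall>v\<in>T'. \<forall>u'\<in>S. \<forall>v'\<in>T. u' + v' = u + v \<longrightarrow> u' \<in> S' \<and> v' \<in> T'"
      by blast
    have fin: "finite S'" "finite T'" using sub assms finite_subset by blast+
    have "u' \<in> ?top e S' \<and> v' \<in> ?top e T'"
      if u: "u \<in> ?top e S'" and v: "v \<in> ?top e T'" and u': "u' \<in> S" and v': "v' \<in> T"
        and eq: "u' + v' = u + v" for u v u' v'
    proof -
      have in': "u' \<in> S'" "v' \<in> T'" using rep u v u' v' eq by blast+
      have "Poly_Mapping.lookup u' e + Poly_Mapping.lookup v' e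
          = Poly_Mapping.lookup u e + Poly_Mapping.lookup v e"
        using arg_cong[OF eq, of "\<lambda>x. Poly_Mapping.lookup x e"] by (simp add: lookup_add)
      moreover have "Poly_Mapping.lookup u' e \<le> Poly_Mapping.lookup u e"
        "Poly_Mapping.lookup v' e \<le> Poly_Mapping.lookup v e"
        using in' u v by blast+
      ultimately have "Poly_Mapping.lookup u' e = Poly_Mapping.lookup u e"
        "Poly_Mapping.lookup v' e = Poly_Mapping.lookup v e" by linarith+
      then show ?thesis using in' u v by simp
    qed
    moreover have "\<forall>u\<in>?top e S'. \<forall>u'\<in>?top e S'. \<forall>e'\<in>insert e F.
        Poly_Mapping.lookup u e' = Poly_Mapping.lookup u' e'"
      using const(1) by (auto intro: order.antisym)
    moreover have "\<forall>u\<in>?top e T'. \<forall>u'\<in>?top e T'. \<forall>e'\<in>insert e F.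
        Poly_Mapping.lookup u e' = Poly_Mapping.lookup u' e'"
      using const(2) by (auto intro: order.antisym)
    moreover have "?top e S' \<subseteq> S" "?top e T' \<subseteq> T" using sub by auto
    ultimately show ?case
      using top[OF fin(1) ne(1), of e] top[OF fin(2) ne(2), of e]
      by (intro exI[of _ "?top e S'"] exI[of _ "?top e T'"] conjI ballI impI) blast+
  qed
  from this[OF finite[of UNIV]] obtain S' T' where sub: "S' \<subseteq> S" "T' \<subseteq> T" and ne: "S' \<noteq> {}" "T' \<noteq> {}"
    and const: "\<forall>u\<in>S'. \<forall>u'\<in>S'. \<forall>e\<in>UNIV. Poly_Mapping.lookup u e = Poly_Mapping.lookup u' e"
      "\<forall>v\<in>T'. \<forall>v'\<in>T'. \<forall>e\<in>UNIV. Poly_Mapping.lookup v e = Poly_Mapping.lookup v' e"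
    and rep: "\<forall>u\<in>S'. \<forall>v\<in>T'. \<forall>u'\<in>S. \<forall>v'\<in>T. u' + v' = u + v \<longrightarrow> u' \<in> S' \<and> v' \<in> T'"
    by blast
  obtain u v where uv: "u \<in> S'" "v \<in> T'" using ne by blast
  have "u' = u \<and> v' = v" if "u' \<in> S" "v' \<in> T" "u' + v' = u + v" for u' v'
  proof -
    have "u' \<in> S'" "v' \<in> T'" using rep uv that by blast+
    then have "Poly_Mapping.lookup u' e = Poly_Mapping.lookup u e"
      "Poly_Mapping.lookup v' e = Poly_Mapping.lookup v e" for e
      using const uv by blast+
    then show ?thesis by (simp add: poly_mapping_eqI)
  qed
  then show thesis using that uv sub by blast
qed

text \<open>If neither factor lies in the ideal, both have exponents in \<open>Z\<close>, that is,
  free of variables from \<open>C\<close>. A sum of two such exponents that arises in only one way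
  has a nonzero coefficient in the product, which therefore has an exponent in \<open>Z\<close> as
  well.\<close>

lemma primeideal_variables_ideal:
  "primeideal (variables_ideal C :: ('e::finite, 'k::field) mpoly set) mpoly_ring"
proof (rule primeidealI)
  show "ideal (variables_ideal C :: ('e, 'k) mpoly set) mpoly_ring"
    unfolding variables_ideal_def by (rule ideal_monomial_ideal[OF upclosed_divisible_exponents])
  have "(1 :: ('e, 'k) mpoly) \<notin> variables_ideal C" by (simp add: mem_variables_ideal_iff)
  then show "carrier mpoly_ring \<noteq> (variables_ideal C :: ('e, 'k) mpoly set)" by auto
  fix f g :: "('e, 'k) mpoly"
  assume "f \<otimes>\<^bsub>mpoly_ring\<^esub> g \<in> variables_ideal C"
  then have fg: "f * g \<in> variables_ideal C" by simp
  show "f \<in> variables_ideal C \<or> g \<in> variables_ideal C"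
  proof (rule ccontr)
    define Z where "Z = {w :: 'e \<Rightarrow>\<^sub>0 nat. \<forall>e\<in>C. Poly_Mapping.lookup w e = 0}"
    assume "\<not> ?thesis"
    then have "Poly_Mapping.keys f \<inter> Z \<noteq> {}" "Poly_Mapping.keys g \<inter> Z \<noteq> {}"
      by (auto simp: mem_variables_ideal_iff Z_def)
    then obtain u v where u: "u \<in> Poly_Mapping.keys f \<inter> Z" and v: "v \<in> Poly_Mapping.keys g \<inter> Z"
      and uniq: "\<And>u' v'. u' \<in> Poly_Mapping.keys f \<inter> Z \<Longrightarrow> v' \<in> Poly_Mapping.keys g \<inter> Z \<Longrightarrow>
        u' + v' = u + v \<Longrightarrow> u' = u \<and> v' = v"
      using obtains_uniquely_represented_sum[of "Poly_Mapping.keys f \<inter> Z" "Poly_Mapping.keys g \<inter> Z"]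
      by (metis finite_Int finite_keys)
    have uvZ: "u + v \<in> Z" using u v by (auto simp: Z_def lookup_add)
    let ?P = "Poly_Mapping.keys f \<times> Poly_Mapping.keys g"
    have "f * g = (\<Sum>(x, y)\<in>?P. Poly_Mapping.single x (Poly_Mapping.lookup f x)
        * Poly_Mapping.single y (Poly_Mapping.lookup g y))"
      by (subst (1) poly_mapping_eq_sum_single[of f], subst (1) poly_mapping_eq_sum_single[of g])
        (simp add: sum_product sum.cartesian_product)
    then have "Poly_Mapping.lookup (f * g) (u + v) =
        (\<Sum>(x, y)\<in>?P. if x + y = u + v then Poly_Mapping.lookup f x * Poly_Mapping.lookup g y else 0)"
      by (simp add: lookup_sum mult_single lookup_single when_def case_prod_unfold)
    also have "\<dots> = (\<Sum>p\<in>?P. if p = (u, v) then Poly_Mapping.lookup f u * Poly_Mapping.lookup g v else 0)"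
    proof (rule sum.cong[OF refl])
      fix p assume p: "p \<in> ?P"
      obtain x y where xy: "p = (x, y)" by (cases p)
      \<comment> \<open>Exponents are natural numbers, so summands of an exponent in
        \<open>Z\<close> lie in \<open>Z\<close> themselves. Uniqueness inside \<open>Z\<close> thus
        extends to all exponents of \<open>f\<close> and \<open>g\<close>.\<close>
      have "x = u \<and> y = v" if "x + y = u + v"
      proof (rule uniq)
        have "x + y \<in> Z" using that uvZ by simp
        then show "x \<in> Poly_Mapping.keys f \<inter> Z" "y \<in> Poly_Mapping.keys g \<inter> Z"
          using p xy by (auto simp: Z_def lookup_add)
      qed (rule that)
      then show "(case p of (x, y) \<Rightarrow> if x + y = u + v then Poly_Mapping.lookup f x * Poly_Mapping.lookup g y else 0)
          = (if p = (u, v) then Poly_Mapping.lookup f u * Poly_Mapping.lookup g v else 0)"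
        using xy by auto
    qed
    also have "\<dots> = Poly_Mapping.lookup f u * Poly_Mapping.lookup g v"
      using u v by simp
    finally have "u + v \<in> Poly_Mapping.keys (f * g)"
      using u v by (simp add: in_keys_iff)
    then show False using fg uvZ by (auto simp: mem_variables_ideal_iff Z_def)
  qed
qed (rule cring_mpoly_ring)

section \<open>Minimal primes and vertex covers\<close>

lemma covers_variables_of_primeideal:
  assumes P: "primeideal P (mpoly_ring :: ('e::finite, 'k::field) mpoly ring)"
    and sub: "monomial_ideal (divisible_exponents \<A>) \<subseteq> P"
  shows "covers \<A> {e. mpoly_var e \<in> P}"
  unfolding covers_def
proof
  fix U assume "U \<in> \<A>"
  then have "squarefree_monomial U \<in> P"
    using sub indicator_exponent_mem[of U \<A>] by (auto simp: squarefree_monomial_eq)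
  moreover have "\<exists>e\<in>U. mpoly_var e \<in> P" if "squarefree_monomial U \<in> P" for U
  proof -
    have "finite U" by simp
    then show ?thesis using that
    proof (induction U)
      case empty
      then have "x \<in> P" for x :: "('e, 'k) mpoly"
        using ideal_mpoly_ringD(3)[OF primeideal.axioms(1)[OF P], of 1 x]
        by (simp add: squarefree_monomial_def)
      then show ?case using primeideal.I_notcarr[OF P] by auto
    next
      case (insert e U)
      then have "mpoly_var e \<otimes>\<^bsub>mpoly_ring\<^esub> squarefree_monomial U \<in> P"
        by (simp add: squarefree_monomial_def)
      then show ?case
        using primeideal.I_prime[OF P, of "mpoly_var e" "squarefree_monomial U"] insert.IH by auto
    qed
  qed
  ultimately show "U \<inter> {e. mpoly_var e \<in> P} \<noteq> {}" by blast
qed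

lemma variables_ideal_subset:
  assumes "ideal P (mpoly_ring :: ('e::finite, 'k::field) mpoly ring)"
    and "\<And>e. e \<in> C \<Longrightarrow> mpoly_var e \<in> P"
  shows "variables_ideal C \<subseteq> P"
  unfolding variables_ideal_def monomial_ideal_subset_iff[OF assms(1)]
proof
  fix w assume "w \<in> divisible_exponents ((\<lambda>e. {e}) ` C)"
  then obtain e v where e: "e \<in> C" and w: "w = v + indicator_exponent {e}"
    by (rule divisible_exponentsE) auto
  have "Poly_Mapping.single v 1 * mpoly_var e \<in> P"
    using ideal_mpoly_ringD(3)[OF assms(1) assms(2)[OF e]] .
  then show "Poly_Mapping.single w 1 \<in> P"
    by (simp add: w mpoly_var_def mult_single indicator_exponent_def)
qed

text \<open>The variables in any prime \<open>Q\<close> above the monomial ideal form a cover. If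
  \<open>Q\<close> lies below \<open>variables_ideal C\<close>, this cover is inside
  \<open>C\<close>, hence equal to \<open>C\<close> by minimality, and \<open>Q\<close> contains all
  generators of \<open>variables_ideal C\<close>.\<close>

lemma minimal_prime_variables_ideal:
  assumes C: "covers \<A> C" and min: "\<And>D. covers \<A> D \<Longrightarrow> D \<subseteq> C \<Longrightarrow> D = C"
  shows "(variables_ideal C :: ('e::finite, 'k::field) mpoly set)
    \<in> minimal_primes mpoly_ring (monomial_ideal (divisible_exponents \<A>))"
proof -
  have "(monomial_ideal (divisible_exponents \<A>) :: ('e, 'k) mpoly set) \<subseteq> variables_ideal C"
    using C by (fastforce simp: mem_variables_ideal_iff monomial_ideal_def divisible_exponents_def
        covers_def Suc_le_eq)
  moreover have "Q = variables_ideal C"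
    if Q: "primeideal Q mpoly_ring" "monomial_ideal (divisible_exponents \<A>) \<subseteq> Q" "Q \<subseteq> variables_ideal C"
    for Q :: "('e, 'k) mpoly set"
  proof
    let ?D = "{e. mpoly_var e \<in> Q}"
    have "?D \<subseteq> C" using Q(3) mpoly_var_mem_variables_ideal_iff by blast
    then have "?D = C" using min covers_variables_of_primeideal[OF Q(1,2)] by blast
    then show "variables_ideal C \<subseteq> Q"
      by (intro variables_ideal_subset primeideal.axioms(1)[OF Q(1)]) auto
  qed (rule Q(3))
  ultimately show ?thesis
    by (simp add: minimal_primes_def primeideal_variables_ideal)
qed

text \<open>Minimal covers yield minimal primes, which gives the first inclusion, since every cover
  contains a minimal one. Conversely each minimal prime contains the variable ideal of a cover, and
  powers are monotone.\<close>

lemma symbolic_power_monomial_ideal: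
  "symbolic_power mpoly_ring (monomial_ideal (divisible_exponents \<A>) :: ('e::finite, 'k::field) mpoly set) n =
    {f. \<forall>w\<in>Poly_Mapping.keys f. \<forall>D. covers \<A> D \<longrightarrow> n \<le> sum (Poly_Mapping.lookup w) D}" (is "?L = ?R")
proof
  show "?L \<subseteq> ?R"
  proof (intro subsetI CollectI ballI allI impI)
    fix f w D assume f: "f \<in> ?L" and w: "w \<in> Poly_Mapping.keys f" and D: "covers \<A> D"
    obtain C where C: "covers \<A> C" "C \<subseteq> D" "\<And>C'. covers \<A> C' \<Longrightarrow> C' \<subseteq> C \<Longrightarrow> C' = C"
      using finite_has_minimal2[of "Collect (covers \<A>)" D] D by auto
    have "f \<in> ideal_power mpoly_ring (variables_ideal C) n"
      using f minimal_prime_variables_ideal[OF C(1,3)] by (auto simp: symbolic_power_def)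
    then have "n \<le> sum (Poly_Mapping.lookup w) C"
      using w by (simp add: ideal_power_variables_ideal)
    also have "\<dots> \<le> sum (Poly_Mapping.lookup w) D" using C(2) by (intro sum_mono2) auto
    finally show "n \<le> sum (Poly_Mapping.lookup w) D" .
  qed
  show "?R \<subseteq> ?L"
  proof
    fix f assume f: "f \<in> ?R"
    have "f \<in> ideal_power mpoly_ring P n"
      if "P \<in> minimal_primes mpoly_ring (monomial_ideal (divisible_exponents \<A>))" for P
    proof -
      let ?D = "{e. mpoly_var e \<in> P}"
      have P: "primeideal P mpoly_ring" "monomial_ideal (divisible_exponents \<A>) \<subseteq> P"
        using that by (auto simp: minimal_primes_def)
      have "f \<in> ideal_power mpoly_ring (variables_ideal ?D) n"
        using f covers_variables_of_primeideal[OF P] by (simp add: ideal_power_variables_ideal)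
      moreover have "variables_ideal ?D \<subseteq> P"
        by (intro variables_ideal_subset primeideal.axioms(1)[OF P(1)]) auto
      ultimately show ?thesis using ideal_power_mono by blast
    qed
    then show "f \<in> ?L" by (simp add: symbolic_power_def)
  qed
qed

lemma symbolic_power_subset_iff:
  "symbolic_power mpoly_ring (monomial_ideal (divisible_exponents \<A>) :: ('e::finite, 'k::field) mpoly set) p
      \<subseteq> ideal_power mpoly_ring (monomial_ideal (divisible_exponents \<A>)) q \<longleftrightarrow>
    (\<forall>w. (\<forall>D. covers \<A> D \<longrightarrow> p \<le> sum (Poly_Mapping.lookup w) D) \<longrightarrow>
      w \<in> exponent_power (divisible_exponents \<A>) q)" (is "?L \<subseteq> ?R \<longleftrightarrow> ?P")
proof
  assume sub: "?L \<subseteq> ?R"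
  show ?P
  proof (intro allI impI)
    fix w assume "\<forall>D. covers \<A> D \<longrightarrow> p \<le> sum (Poly_Mapping.lookup w) D"
    then have "Poly_Mapping.single w 1 \<in> ?L" by (simp add: symbolic_power_monomial_ideal)
    then have "Poly_Mapping.single w 1 \<in> ?R" using sub by blast
    then show "w \<in> exponent_power (divisible_exponents \<A>) q"
      by (simp add: ideal_power_monomial_ideal upclosed_divisible_exponents)
  qed
next
  assume ?P
  then show "?L \<subseteq> ?R"
    unfolding symbolic_power_monomial_ideal ideal_power_monomial_ideal[OF upclosed_divisible_exponents]
    by (auto simp: monomial_ideal_def)
qed

section \<open>Asymptotic resurgence via blocking pairs\<close>

text \<open>Linear programming duality for fractional packings, obtained by separating \<open>w / N\<close> from the
  Newton polyhedron.\<close>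

lemma fractional_packing_alternative:
  fixes \<A> :: "'e::finite set set" and w :: "'e \<Rightarrow> real"
  assumes w: "\<And>e. 0 \<le> w e" and N: "0 < N"
  obtains (packing) m where "\<And>U. 0 \<le> m U" "sum m \<A> = N" "\<And>e. sum m {U \<in> \<A>. e \<in> U} \<le> w e"
  | (weight) b where "\<And>e. 0 \<le> b e" "\<And>U. U \<in> \<A> \<Longrightarrow> 1 \<le> sum b U" "(\<Sum>e\<in>UNIV. b e * w e) < N"
proof -
  define ind :: "'e set \<Rightarrow> real ^ 'e" where "ind U = (\<chi> e. if e \<in> U then 1 else 0)" for U
  define z :: "real ^ 'e" where "z = (\<chi> e. w e / N)"
  define K where "K = {x :: real ^ 'e. \<forall>e. 0 \<le> x $ e}"
  \<comment> \<open>The Newton polyhedron: the convex hull of the indicator vectors plus the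
    nonnegative orthant. If \<open>z\<close> belongs to it, convex coefficients scaled by
    \<open>N\<close> form the packing; if not, a separating hyperplane scaled by its offset gives
    the weight.\<close>
  define Q where "Q = (\<Union>x\<in>convex hull (ind ` \<A>). \<Union>y\<in>K. {x + y})"
  have inj: "inj ind"
    by (rule injI) (auto simp: ind_def vec_eq_iff split: if_splits)
  have "closed K"
    unfolding K_def by (intro closed_Collect_all closed_Collect_le continuous_on_const
        linear_continuous_on bounded_linear_vec_nth)
  have "convex K"
    by (rule convexI) (auto simp: K_def)
  have "closed Q"
    unfolding Q_def
    by (intro compact_closed_sums finite_imp_compact_convex_hull \<open>closed K\<close>) simp
  have "convex Q"
    unfolding Q_def by (intro convex_sums convex_convex_hull \<open>convex K\<close>)
  have inner: "x \<bullet> y = (\<Sum>e\<in>UNIV. x $ e * y $ e)" for x y :: "real ^ 'e"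
    by (simp add: inner_vec_def)
  show thesis
  proof (cases "z \<in> Q")
    case True
    then obtain x y where x: "x \<in> convex hull (ind ` \<A>)" and y: "y \<in> K" and z: "z = x + y"
      by (auto simp: Q_def)
    obtain u where u: "\<forall>v\<in>ind ` \<A>. 0 \<le> u v" "sum u (ind ` \<A>) = 1" "(\<Sum>v\<in>ind ` \<A>. u v *\<^sub>R v) = x"
      using x by (auto simp: convex_hull_finite)
    define m where "m U = (if U \<in> \<A> then N * u (ind U) else 0)" for U
    have inj': "inj_on ind \<A>" using inj inj_on_subset by blast
    have m0: "0 \<le> m U" for U using u(1) N by (simp add: m_def)
    have "sum m \<A> = N * sum u (ind ` \<A>)"
      by (simp add: m_def sum.reindex[OF inj'] sum_distrib_left)
    then have mN: "sum m \<A> = N" using u(2) by simp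
    have "sum m {U \<in> \<A>. e \<in> U} \<le> w e" for e
    proof -
      have "x = (\<Sum>U\<in>\<A>. u (ind U) *\<^sub>R ind U)"
        using u(3) by (simp add: sum.reindex[OF inj'])
      then have "N * x $ e = (\<Sum>U\<in>\<A>. N * (u (ind U) * (if e \<in> U then 1 else 0)))"
        by (simp add: ind_def sum_distrib_left)
      also have "\<dots> = (\<Sum>U\<in>\<A>. if e \<in> U then m U else 0)"
        by (intro sum.cong) (auto simp: m_def)
      also have "\<dots> = sum m {U \<in> \<A>. e \<in> U}"
        by (simp add: sum.inter_filter)
      finally have "sum m {U \<in> \<A>. e \<in> U} = N * x $ e" ..
      also have "\<dots> \<le> N * z $ e"
        using y N by (simp add: z K_def)
      finally show ?thesis using N by (simp add: z_def)
    qed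
    then show thesis using packing m0 mN by blast
  next
    case False
    then obtain a c where a: "a \<bullet> z < c" "\<And>x. x \<in> Q \<Longrightarrow> c < a \<bullet> x"
      using separating_hyperplane_closed_point[OF \<open>convex Q\<close> \<open>closed Q\<close>] by blast
    show thesis
    proof (cases "\<A> = {}")
      case True
      then show thesis using weight[of "\<lambda>_. 0"] N by simp
    next
      case False
      then obtain U0 where U0: "U0 \<in> \<A>" by blast
      have inQ: "ind U + y \<in> Q" if "U \<in> \<A>" "y \<in> K" for U y
        using that hull_inc[of "ind U" "ind ` \<A>" convex] by (auto simp: Q_def)
      have a0: "0 \<le> a $ e" for e
      proof (rule ccontr)
        assume "\<not> 0 \<le> a $ e"
        then have neg: "a $ e < 0" by simp
        have "0 < a \<bullet> ind U0 - c"
          using a(2)[OF inQ[OF U0, of 0]] by (simp add: K_def)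
        \<comment> \<open>Moving along coordinate \<open>e\<close> stays inside \<open>Q\<close>;
          with a negative coefficient the functional falls to exactly \<open>c\<close> after this
          distance, against strict separation.\<close>
        define t where "t = (a \<bullet> ind U0 - c) / (- a $ e)"
        have "0 \<le> t" using \<open>0 < a \<bullet> ind U0 - c\<close> neg
          unfolding t_def by (intro divide_nonneg_nonneg) simp_all
        then have "t *\<^sub>R axis e 1 \<in> K" by (simp add: K_def axis_def)
        then have "c < a \<bullet> (ind U0 + t *\<^sub>R axis e 1)" using a(2) inQ U0 by blast
        also have "\<dots> = a \<bullet> ind U0 + t * a $ e" by (simp add: inner_add_right inner_axis)
        also have "t * a $ e = c - a \<bullet> ind U0" using neg by (simp add: t_def field_simps)
        finally show False by simp
      qed
      have "0 \<le> a \<bullet> z" unfolding inner using a0 w N by (intro sum_nonneg) (simp add: z_def)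
      then have c: "0 < c" using a(1) by simp
      have "1 \<le> sum (\<lambda>e. a $ e / c) U" if "U \<in> \<A>" for U
      proof -
        have "c < a \<bullet> ind U" using a(2)[OF inQ[OF that, of 0]] by (simp add: K_def)
        also have "\<dots> = (\<Sum>e\<in>UNIV. if e \<in> U then a $ e else 0)"
          unfolding inner by (intro sum.cong) (auto simp: ind_def)
        also have "\<dots> = sum (($) a) U" by (simp add: sum.If_cases)
        finally show ?thesis using c by (simp add: sum_divide_distrib[symmetric])
      qed
      moreover have "(\<Sum>e\<in>UNIV. a $ e / c * w e) < N"
      proof -
        have "(\<Sum>e\<in>UNIV. a $ e / c * w e) = N / c * (a \<bullet> z)"
          unfolding inner sum_distrib_left using N by (intro sum.cong) (auto simp: z_def)
        also have "\<dots> < N / c * c" using a(1) N c by (intro mult_strict_left_mono) auto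
        finally show ?thesis using c by simp
      qed
      ultimately show thesis using weight[of "\<lambda>e. a $ e / c"] a0 c by simp
    qed
  qed
qed

text \<open>Rounding down loses at most 1 for each member of the family; the surplus
  \<open>card \<A>\<close> in the total pays for this.\<close>

lemma integral_packing_of_fractional:
  fixes m :: "'e::finite set \<Rightarrow> real"
  assumes "\<And>U. 0 \<le> m U" and "sum m \<A> = real n + real (card \<A>)"
    and "\<And>e. sum m {U \<in> \<A>. e \<in> U} \<le> real (Poly_Mapping.lookup w e)"
  shows "w \<in> exponent_power (divisible_exponents \<A>) n"
proof (rule mem_exponent_power_of_packing)
  let ?m = "\<lambda>U. nat \<lfloor>m U\<rfloor>"
  have le: "real (?m U) \<le> m U" and ge: "m U - 1 \<le> real (?m U)" for U
    using assms(1)[of U] by linarith+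
  have "sum m \<A> - real (card \<A>) = (\<Sum>U\<in>\<A>. m U - 1)" by (simp add: sum_subtractf)
  also have "\<dots> \<le> (\<Sum>U\<in>\<A>. real (?m U))" using ge by (rule sum_mono)
  finally have "real n \<le> real (sum ?m \<A>)" using assms(2) by simp
  then show "n \<le> sum ?m \<A>" by (simp only: of_nat_le_iff)
  fix e
  have "real (sum ?m {U \<in> \<A>. e \<in> U}) \<le> sum m {U \<in> \<A>. e \<in> U}"
    unfolding of_nat_sum using le by (rule sum_mono)
  then have "real (sum ?m {U \<in> \<A>. e \<in> U}) \<le> real (Poly_Mapping.lookup w e)"
    using assms(3)[of e] by linarith
  then show "sum ?m {U \<in> \<A>. e \<in> U} \<le> Poly_Mapping.lookup w e" by (simp only: of_nat_le_iff)
qed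

text \<open>An exponent \<open>w\<close> in the symbolic but not in the ordinary power, divided by
  \<open>s * t\<close>, supplies \<open>a\<close>. It admits no fractional packing of total
  \<open>r * t + card \<A>\<close>, since rounding would put it in the ordinary power, so duality
  supplies \<open>b\<close>.\<close>

lemma blocking_pair_of_noncontainment:
  fixes \<A> :: "'e::finite set set"
  assumes s: "0 < s" and r: "0 < r" and \<epsilon>: "0 < \<epsilon>"
    and ev: "\<forall>\<^sub>F t in sequentially.
      \<not> symbolic_power mpoly_ring (monomial_ideal (divisible_exponents \<A>) :: ('e, 'k::field) mpoly set) (s * t)
        \<subseteq> ideal_power mpoly_ring (monomial_ideal (divisible_exponents \<A>)) (r * t)"
  obtains a b where "blocking_pair \<A> a b" "(\<Sum>e\<in>UNIV. a e * b e) < real r / real s + \<epsilon>"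
proof -
  obtain t0 where t0: "\<And>t. t0 \<le> t \<Longrightarrow>
      \<not> symbolic_power mpoly_ring (monomial_ideal (divisible_exponents \<A>) :: ('e, 'k) mpoly set) (s * t)
        \<subseteq> ideal_power mpoly_ring (monomial_ideal (divisible_exponents \<A>)) (r * t)"
    using ev unfolding eventually_sequentially by blast
  \<comment> \<open>Chosen so that the rounding surplus \<open>card \<A>\<close>, divided by
    \<open>s * t\<close>, falls below \<epsilon>.\<close>
  obtain n where n: "real (card \<A>) / (real s * \<epsilon>) < real n" using reals_Archimedean2 by blast
  define t where "t = t0 + n + 1"
  have t: "0 < t" "t0 \<le> t" by (auto simp: t_def)
  have "real (card \<A>) / (real s * \<epsilon>) < real t" using n by (simp add: t_def)
  then have small: "real (card \<A>) / (real s * real t) < \<epsilon>"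
    using s \<epsilon> t by (simp add: field_simps)
  obtain w where cov: "\<And>D. covers \<A> D \<Longrightarrow> s * t \<le> sum (Poly_Mapping.lookup w) D"
    and w: "w \<notin> exponent_power (divisible_exponents \<A>) (r * t)"
    using t0[OF t(2)] unfolding symbolic_power_subset_iff by blast
  have pos: "0 < real (r * t) + real (card \<A>)" using r t by (simp add: add_pos_nonneg)
  show thesis
  proof (rule fractional_packing_alternative[of "\<lambda>e. real (Poly_Mapping.lookup w e)", OF _ pos])
    fix m :: "'e set \<Rightarrow> real"
    assume "\<And>U. 0 \<le> m U" "sum m \<A> = real (r * t) + real (card \<A>)"
      "\<And>e. sum m {U \<in> \<A>. e \<in> U} \<le> real (Poly_Mapping.lookup w e)"
    then have "w \<in> exponent_power (divisible_exponents \<A>) (r * t)"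
      by (rule integral_packing_of_fractional)
    then show thesis using w by simp
  next
    fix b :: "'e \<Rightarrow> real"
    assume b: "\<And>e. 0 \<le> b e" "\<And>U. U \<in> \<A> \<Longrightarrow> 1 \<le> sum b U"
      and less: "(\<Sum>e\<in>UNIV. b e * real (Poly_Mapping.lookup w e)) < real (r * t) + real (card \<A>)"
    have st: "0 < real s * real t" using s t by simp
    define a where "a e = real (Poly_Mapping.lookup w e) / (real s * real t)" for e
    have "1 \<le> sum a D" if "covers \<A> D" for D
    proof -
      have "real (s * t) \<le> real (sum (Poly_Mapping.lookup w) D)"
        using cov[OF that] by (simp only: of_nat_le_iff)
      then show ?thesis using st by (simp add: a_def sum_divide_distrib[symmetric])
    qed
    then have "blocking_pair \<A> a b" using b st by (simp add: blocking_pair_def a_def)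
    moreover have "(\<Sum>e\<in>UNIV. a e * b e) < real r / real s + \<epsilon>"
    proof -
      have "(\<Sum>e\<in>UNIV. a e * b e) = (\<Sum>e\<in>UNIV. b e * real (Poly_Mapping.lookup w e)) / (real s * real t)"
        unfolding sum_divide_distrib by (intro sum.cong) (simp_all add: a_def)
      also have "\<dots> < (real (r * t) + real (card \<A>)) / (real s * real t)"
        using less st by (rule divide_strict_right_mono)
      also have "\<dots> = real r / real s + real (card \<A>) / (real s * real t)"
        using s t by (simp add: field_simps)
      finally show ?thesis using small by simp
    qed
    ultimately show thesis by (rule that)
  qed simp
qed

text \<open>Rounding \<open>s * t\<close> times \<open>a\<close> up to integers gives an exponent in
  the symbolic power. Rounding adds at most \<open>sum b UNIV\<close> to its
  \<open>b\<close>-weight, whereas the gap to \<open>r * t\<close> grows like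
  \<open>\<delta> * t\<close>, so for large \<open>t\<close> the weight is too small for the
  ordinary power.\<close>

lemma noncontainment_of_blocking_pair:
  fixes \<A> :: "'e::finite set set"
  assumes s: "0 < s" and ab: "blocking_pair \<A> a b"
    and less: "(\<Sum>e\<in>UNIV. a e * b e) < real r / real s"
  shows "\<forall>\<^sub>F t in sequentially.
    \<not> symbolic_power mpoly_ring (monomial_ideal (divisible_exponents \<A>) :: ('e, 'k::field) mpoly set) (s * t)
      \<subseteq> ideal_power mpoly_ring (monomial_ideal (divisible_exponents \<A>)) (r * t)"
proof -
  have a: "\<And>e. 0 \<le> a e" "\<And>D. covers \<A> D \<Longrightarrow> 1 \<le> sum a D"
    and b: "\<And>e. 0 \<le> b e" "\<And>U. U \<in> \<A> \<Longrightarrow> 1 \<le> sum b U"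
    using ab by (auto simp: blocking_pair_def)
  define \<delta> where "\<delta> = real r - real s * (\<Sum>e\<in>UNIV. a e * b e)"
  have \<delta>: "0 < \<delta>" using less s by (simp add: \<delta>_def field_simps)
  obtain n where n: "sum b UNIV / \<delta> < real n" using reals_Archimedean2 by blast
  have "\<not> symbolic_power mpoly_ring (monomial_ideal (divisible_exponents \<A>) :: ('e, 'k) mpoly set) (s * t)
      \<subseteq> ideal_power mpoly_ring (monomial_ideal (divisible_exponents \<A>)) (r * t)" if "n \<le> t" for t
  proof
    assume sub: "symbolic_power mpoly_ring (monomial_ideal (divisible_exponents \<A>) :: ('e, 'k) mpoly set) (s * t)
      \<subseteq> ideal_power mpoly_ring (monomial_ideal (divisible_exponents \<A>)) (r * t)"
    define x where "x e = real s * real t * a e" for e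
    define w where "w = Abs_poly_mapping (\<lambda>e. nat \<lceil>x e\<rceil>)"
    have w: "Poly_Mapping.lookup w e = nat \<lceil>x e\<rceil>" for e by (simp add: w_def)
    have x0: "0 \<le> x e" for e using a by (simp add: x_def)
    have wx: "x e \<le> real (Poly_Mapping.lookup w e)" "real (Poly_Mapping.lookup w e) \<le> x e + 1" for e
      unfolding w using x0[of e] by linarith+
    have "s * t \<le> sum (Poly_Mapping.lookup w) D" if "covers \<A> D" for D
    proof -
      have "real (s * t) * 1 \<le> real (s * t) * sum a D"
        using a(2)[OF that] by (intro mult_left_mono) auto
      also have "\<dots> = sum x D" by (simp add: x_def sum_distrib_left)
      also have "\<dots> \<le> (\<Sum>e\<in>D. real (Poly_Mapping.lookup w e))" using wx(1) by (rule sum_mono)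
      finally have "real (s * t) \<le> real (sum (Poly_Mapping.lookup w) D)" by simp
      then show ?thesis by (simp only: of_nat_le_iff)
    qed
    then have "w \<in> exponent_power (divisible_exponents \<A>) (r * t)"
      using sub unfolding symbolic_power_subset_iff by blast
    then have "real (r * t) \<le> (\<Sum>e\<in>UNIV. b e * real (Poly_Mapping.lookup w e))"
      using b by (rule weight_ge_of_mem_exponent_power)
    also have "\<dots> \<le> (\<Sum>e\<in>UNIV. b e * (x e + 1))"
      using wx(2) b(1) by (intro sum_mono mult_left_mono)
    also have "\<dots> = real s * real t * (\<Sum>e\<in>UNIV. a e * b e) + sum b UNIV"
      by (simp add: x_def distrib_left sum.distrib sum_distrib_left mult_ac)
    finally have "\<delta> * real t \<le> sum b UNIV" by (simp add: \<delta>_def algebra_simps)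
    moreover have "sum b UNIV < \<delta> * real t"
    proof -
      have "sum b UNIV / \<delta> < real t" using n that by linarith
      then show ?thesis using \<delta> by (simp add: pos_divide_less_eq mult.commute)
    qed
    ultimately show False by simp
  qed
  then show ?thesis unfolding eventually_sequentially by blast
qed

text \<open>A ratio \<open>s / r\<close> in the first index set yields pairs with product
  arbitrarily close to or below \<open>r / s\<close>. Transferred to the second family, they place
  ratios converging to \<open>s / r\<close> in the second index set, so its supremum is at least
  \<open>s / r\<close>.\<close>

theorem asymptotic_resurgence_le_of_blocking_pairs:
  fixes \<A>1 \<A>2 :: "'e::finite set set"
  assumes pairs: "\<And>a b. blocking_pair \<A>1 a b \<Longrightarrow>
    \<exists>a' b'. blocking_pair \<A>2 a' b' \<and> (\<Sum>e\<in>UNIV. a' e * b' e) \<le> (\<Sum>e\<in>UNIV. a e * b e)"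
  shows "asymptotic_resurgence mpoly_ring (Idl\<^bsub>mpoly_ring\<^esub> (squarefree_monomial ` \<A>1) :: ('e, 'k::field) mpoly set)
    \<le> asymptotic_resurgence mpoly_ring (Idl\<^bsub>mpoly_ring\<^esub> (squarefree_monomial ` \<A>2) :: ('e, 'k) mpoly set)"
  unfolding genideal_squarefree_monomials
proof -
  let ?I1 = "monomial_ideal (divisible_exponents \<A>1) :: ('e, 'k) mpoly set"
  let ?I2 = "monomial_ideal (divisible_exponents \<A>2) :: ('e, 'k) mpoly set"
  show "asymptotic_resurgence mpoly_ring ?I1 \<le> asymptotic_resurgence mpoly_ring ?I2"
    unfolding asymptotic_resurgence_def[of _ ?I1]
  proof (rule Sup_least, clarify)
    fix s r :: nat
    assume s: "0 < s" and r: "0 < r" and ev: "\<forall>\<^sub>F t in sequentially.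
      \<not> symbolic_power mpoly_ring ?I1 (s * t) \<subseteq> ideal_power mpoly_ring ?I1 (r * t)"
    \<comment> \<open>Adding 1 to the denominator gives the slack absorbed by the error term in
      \<open>blocking_pair_of_noncontainment\<close>.\<close>
    have bound: "ereal (real (s * Suc j) / real (r * Suc j + 1)) \<le> asymptotic_resurgence mpoly_ring ?I2" for j
    proof -
      have sj: "0 < s * Suc j" and rj: "0 < r * Suc j + 1" using s by simp_all
      have "0 < 1 / real (s * Suc j)"
        unfolding zero_less_divide_1_iff of_nat_0_less_iff by (rule sj)
      then obtain a b where ab: "blocking_pair \<A>1 a b"
        "(\<Sum>e\<in>UNIV. a e * b e) < real r / real s + 1 / real (s * Suc j)"
        using blocking_pair_of_noncontainment[OF s r _ ev] by blast
      have "real r / real s + 1 / real (s * Suc j) = real (r * Suc j + 1) / real (s * Suc j)"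
      proof -
        have "real r / real s + 1 / (real s * J) = (real r * J + 1) / (real s * J)" if "0 < J" for J
          using s that by (simp add: field_simps)
        from this[of "real (Suc j)"] show ?thesis
          unfolding of_nat_mult of_nat_add of_nat_1 by simp
      qed
      with ab(2) have less: "(\<Sum>e\<in>UNIV. a e * b e) < real (r * Suc j + 1) / real (s * Suc j)"
        by (simp only:)
      obtain a' b' where ab': "blocking_pair \<A>2 a' b'"
        "(\<Sum>e\<in>UNIV. a' e * b' e) \<le> (\<Sum>e\<in>UNIV. a e * b e)"
        using pairs[OF ab(1)] by blast
      have "\<forall>\<^sub>F t in sequentially. \<not> symbolic_power mpoly_ring ?I2 (s * Suc j * t)
          \<subseteq> ideal_power mpoly_ring ?I2 ((r * Suc j + 1) * t)"
        by (rule noncontainment_of_blocking_pair[OF sj ab'(1) order.strict_trans1[OF ab'(2) less]])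
      then show ?thesis
        unfolding asymptotic_resurgence_def using sj rj
        by (intro Sup_upper CollectI exI[of _ "s * Suc j"] exI[of _ "r * Suc j + 1"] conjI refl)
    qed
    have "(\<lambda>j. real s / (real r + inverse (real (Suc j)))) \<longlonglongrightarrow> real s / (real r + 0)"
      using r by (intro tendsto_intros LIMSEQ_inverse_real_of_nat) auto
    moreover have "real s / (real r + inverse (real (Suc j))) = real (s * Suc j) / real (r * Suc j + 1)" for j
    proof -
      have "real s / (real r + inverse J) = (real s * J) / (real r * J + 1)" if "0 < J" for J
      proof -
        have "real r * J + 1 = (real r + inverse J) * J" using that by (simp add: distrib_right)
        then show ?thesis using that by simp
      qed
      from this[of "real (Suc j)"] show ?thesis
        unfolding of_nat_mult of_nat_add of_nat_1 by simp
    qed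
    ultimately have "(\<lambda>j. real (s * Suc j) / real (r * Suc j + 1)) \<longlonglongrightarrow> real s / real r"
      by (simp only: add_0_right)
    then have "(\<lambda>j. ereal (real (s * Suc j) / real (r * Suc j + 1))) \<longlonglongrightarrow> ereal (real s / real r)"
      by (simp only: lim_ereal)
    then show "ereal (real s / real r) \<le> asymptotic_resurgence mpoly_ring ?I2"
      by (rule LIMSEQ_le_const2) (use bound in blast)
  qed
qed

theorem theorem5p2:
  fixes indep1 indep2 :: "'e::finite set \<Rightarrow> bool" and k :: nat
  assumes "matroid UNIV indep1" and "matroid UNIV indep2"
    and "matroid_rank indep1 = k" and "matroid_rank indep2 = k"
    and "k < card (UNIV :: 'e set)"
    and "weak_order_le indep1 indep2"
  shows "asymptotic_resurgence (mpoly_ring :: ('e, 'k::field) mpoly ring) (facet_ideal indep1)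
           \<le> asymptotic_resurgence (mpoly_ring :: ('e, 'k) mpoly ring) (facet_ideal indep2)
       \<and> asymptotic_resurgence (mpoly_ring :: ('e, 'k) mpoly ring) (stanley_reisner_ideal indep1)
           \<le> asymptotic_resurgence (mpoly_ring :: ('e, 'k) mpoly ring) (stanley_reisner_ideal indep2)"
proof -
  \<comment> \<open>Equal rank is what makes a basis of the first matroid, known to be independent
    in the second, a basis there too.\<close>
  have sub: "matroid_bases indep1 \<subseteq> matroid_bases indep2"
    using assms by (auto simp: matroid.matroid_bases_eq[OF assms(1)] matroid.matroid_bases_eq[OF assms(2)]
        weak_order_le_def)
  show ?thesis
    unfolding facet_ideal_def stanley_reisner_ideal_def
  proof (intro conjI asymptotic_resurgence_le_of_blocking_pairs)
    fix a b
    assume "blocking_pair (matroid_bases indep1) a b"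
    then show "\<exists>a' b'. blocking_pair (matroid_bases indep2) a' b' \<and>
        (\<Sum>e\<in>UNIV. a' e * b' e) \<le> (\<Sum>e\<in>UNIV. a e * b e)"
      using blocking_pair_bases_mono[OF assms(1,2) sub] by metis
  next
    fix a b
    assume "blocking_pair (matroid_circuits UNIV indep1) a b"
    then show "\<exists>a' b'. blocking_pair (matroid_circuits UNIV indep2) a' b' \<and>
        (\<Sum>e\<in>UNIV. a' e * b' e) \<le> (\<Sum>e\<in>UNIV. a e * b e)"
      using blocking_pair_circuits_mono[OF assms(1,2) sub] by metis
  qed
qed

end
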